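(* There exists a constant $K_0$ such that for every constant $K\ge K_0$ the following holds. Let $A$ be a random $n\times n$ matrix constructed as follows: choose a uniformly random set of $Kn\log n$ of the $n^2$ entries (positions), give each chosen entry an independent uniformly random integer from $[n]=\{1,\dots,n\}$, and fill the remaining entries with zeroes. Then the probability that $A$ contains a latin transversal tends to $1$ as $n\to\infty$.
   Context: A latin transversal contained in $A$ is an $n\times n$ matrix $B$, each of whose non-zero entries equals the entry of $A$ in the same position, such that $B$ has exactly one non-zero entry in each row and in each column, and each $x\in[n]$ appears as a non-zero entry of $B$. Here $\log$ is the natural logarithm, and $Kn\log n$ is understood to be rounded to an integer, i.e. $\lceil Kn\log n\rceil$. *)

theory Defs
  imports "HOL-Probability.Probability" "HOL-Probability.Product_PMF"
begin

text \<open>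
  An \<open>n \<times> n\<close> matrix over the natural numbers is a function on pairs (row, column), whose
  positions are the pairs in \<open>{1..n} \<times> {1..n}\<close>. Values at other pairs are never inspected.
\<close>

definition positions :: "nat \<Rightarrow> (nat \<times> nat) set" where
  "positions n = {1..n} \<times> {1..n}"

definition is_latin_transversal_of ::
    "nat \<Rightarrow> (nat \<times> nat \<Rightarrow> nat) \<Rightarrow> (nat \<times> nat \<Rightarrow> nat) \<Rightarrow> bool" where
  "is_latin_transversal_of n A B \<longleftrightarrow>
     (\<forall>p\<in>positions n. B p \<noteq> 0 \<longrightarrow> B p = A p) \<and>
     (\<forall>i\<in>{1..n}. \<exists>!j. j \<in> {1..n} \<and> B (i, j) \<noteq> 0) \<and>
     (\<forall>j\<in>{1..n}. \<exists>!i. i \<in> {1..n} \<and> B (i, j) \<noteq> 0) \<and>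
     (\<forall>x\<in>{1..n}. \<exists>p\<in>positions n. B p = x)"

definition contains_latin_transversal :: "nat \<Rightarrow> (nat \<times> nat \<Rightarrow> nat) \<Rightarrow> bool" where
  "contains_latin_transversal n A \<longleftrightarrow> (\<exists>B. is_latin_transversal_of n A B)"

text \<open>
  \<open>Pi_pmf S 0\<close> draws the values on \<open>S\<close> independently and sets all others to \<open>0\<close>.
  If \<open>m > n\<^sup>2\<close>, there is no set of \<open>m\<close> positions and the distribution is unspecified;
  for \<open>m = \<lceil>K n log n\<rceil>\<close> with \<open>K\<close> fixed this concerns only finitely many \<open>n\<close>.
\<close>

definition random_matrix :: "nat \<Rightarrow> nat \<Rightarrow> (nat \<times> nat \<Rightarrow> nat) pmf" where
  "random_matrix n m =
     bind_pmf (pmf_of_set {S. S \<subseteq> positions n \<and> card S = m})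
       (\<lambda>S. Pi_pmf S 0 (\<lambda>_. pmf_of_set {1..n}))"

end

theory Submission
  imports Defs "HOL-Combinatorics.Permutations"
begin


text \<open>
  Regard a matrix as a partial map from positions to symbols. A latin transversal is a pair of
  permutations \<open>\<sigma>\<close>, \<open>\<tau>\<close>: it demands the symbol \<open>\<tau> i\<close> at position \<open>(i, \<sigma> i)\<close> for every row \<open>i\<close>. A
  fixed set of \<open>t\<close> demands occurs in at most a fraction \<open>((n - t)! / n!)\<^sup>2 \<le> (e / n)\<^bsup>2t\<^esup>\<close> of all
  these transversals. Hence, with \<open>p = (e / n)\<^sup>2\<close>, every family \<open>U\<close> of partial maps that covers
  the transversals, in the sense that each transversal extends a member of \<open>U\<close>, has weight
  \<open>\<Sum>T\<in>U. p ^ card (dom T)\<close> at least \<open>1\<close> (\<open>one_le_weight_cover_transversals\<close>).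

  The Park--Pham argument turns this absence of cheap covers into the presence of a transversal.
  Reveal the random matrix in rounds. After a round \<open>W\<close>, replace every target \<open>S\<close> by its fragment,
  the smallest part still missing of a target inside the union of \<open>W\<close> and \<open>S\<close>. Fragments that have
  more than half of the permitted size have small expected total weight
  (\<open>expected_weight_large_fragments\<close>): the matrix \<open>W ++ T\<close>, with the fragment \<open>T\<close> planted into
  \<open>W\<close>, almost determines \<open>T\<close>, because \<open>T\<close> is a part of every target that this matrix contains; and
  planting changes the law of the matrix by a factor that is under control (\<open>expectation_plant\<close>).
  The other fragments are the targets of the next round, and their size has halved. If no target
  survives to the end, then the large fragments of all rounds together cover the original family,
  so their weight is at least \<open>1\<close>, which is unlikely by Markov's inequality
  (\<open>miss_le_of_covers_heavy\<close>). A round with targets of size \<open>l\<close> is given the density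
  \<open>16 p n (1 + ln n / l)\<close> per position. The first summand accumulates over the \<open>log\<^sub>2 n\<close> rounds
  and the second one is a geometric series, so about \<open>n ln n\<close> entries suffice in total, and the
  second summand makes the error of the last rounds tend to \<open>0\<close>.

  Two comparisons connect the rounds with the model of the theorem. A position holds a single
  symbol, whereas the union of two rounds may offer two; but a target uses at most one symbol per
  position, and for it a single round of the added densities is at least as good as two rounds
  (\<open>miss_merge_rounds\<close>). Finally, the rounds fill each position independently, whereas the theorem
  fixes the number of filled positions; missing all transversals is a decreasing property of the
  filled set, so it is at most twice as likely for \<open>m\<close> positions as for independently chosen ones
  with mean at most \<open>m / 2\<close> (\<open>miss_fixed_size\<close>).
\<close>

section \<open>Expectations over finite products\<close>

lemma expectation_bind_finite:
  fixes h :: "'b \<Rightarrow> real"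
  assumes "finite (set_pmf p)" "\<And>x. x \<in> set_pmf p \<Longrightarrow> finite (set_pmf (f x))"
  shows "measure_pmf.expectation (bind_pmf p f) h =
           measure_pmf.expectation p (\<lambda>x. measure_pmf.expectation (f x) h)"
  using assms
  by (simp add: pmf_expectation_bind[OF assms(1) _ order.refl] integral_measure_pmf[OF assms(1)])

lemma expectation_mono_finite:
  fixes f g :: "'a \<Rightarrow> real"
  assumes "finite (set_pmf p)" "\<And>x. x \<in> set_pmf p \<Longrightarrow> f x \<le> g x"
  shows "measure_pmf.expectation p f \<le> measure_pmf.expectation p g"
  by (intro integral_mono_AE integrable_measure_pmf_finite assms(1))
     (simp add: AE_measure_pmf_iff assms(2))

lemma finite_set_Pi_pmf:
  assumes "finite I" "\<And>x. x \<in> I \<Longrightarrow> finite (set_pmf (p x))"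
  shows "finite (set_pmf (Pi_pmf I d p))"
  using assms by (simp add: set_Pi_pmf finite_PiE_dflt)

lemma expectation_Pi_pmf_insert:
  fixes F :: "('a \<Rightarrow> 'b) \<Rightarrow> real"
  assumes "finite I" "x \<notin> I" "\<And>y. y \<in> insert x I \<Longrightarrow> finite (set_pmf (p y))"
  shows "measure_pmf.expectation (Pi_pmf (insert x I) d p) F =
           measure_pmf.expectation (p x)
             (\<lambda>y. measure_pmf.expectation (Pi_pmf I d p) (\<lambda>f. F (f(x := y))))"
proof -
  have "finite (set_pmf (Pi_pmf I d p))"
    using assms by (intro finite_set_Pi_pmf) auto
  then show ?thesis
    using assms(3)
    by (simp add: Pi_pmf_insert'[OF assms(1,2)] expectation_bind_finite)
qed

lemma expectation_swap_finite:
  fixes F :: "'a \<Rightarrow> 'b \<Rightarrow> real"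
  assumes "finite (set_pmf p)" "finite (set_pmf r)"
  shows "measure_pmf.expectation p (\<lambda>x. measure_pmf.expectation r (F x)) =
         measure_pmf.expectation r (\<lambda>y. measure_pmf.expectation p (\<lambda>x. F x y))"
  using assms
  by (simp add: integral_measure_pmf[OF assms(1)] integral_measure_pmf[OF assms(2)]
                sum_distrib_left mult_ac sum.swap[of _ "set_pmf p"])

text \<open>
  Replacing the factors one at a time: a comparison of two laws at each single coordinate, with
  the other coordinates frozen arbitrarily, extends to the product laws.
\<close>

lemma expectation_Pi_pmf_mono:
  fixes F :: "('a \<Rightarrow> 'b) \<Rightarrow> real"
  assumes "finite I"
    and "\<And>x. x \<in> I \<Longrightarrow> finite (set_pmf (p x))" "\<And>x. x \<in> I \<Longrightarrow> finite (set_pmf (r x))"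
    and "\<And>x f. x \<in> I \<Longrightarrow> measure_pmf.expectation (p x) (\<lambda>y. F (f(x := y)))
                      \<le> measure_pmf.expectation (r x) (\<lambda>y. F (f(x := y)))"
  shows "measure_pmf.expectation (Pi_pmf I d p) F \<le> measure_pmf.expectation (Pi_pmf I d r) F"
  using assms
proof (induction I arbitrary: F rule: finite_induct)
  case empty
  then show ?case by simp
next
  case (insert x I)
  have IH: "measure_pmf.expectation (Pi_pmf I d p) (\<lambda>f. F (f(x := v)))
        \<le> measure_pmf.expectation (Pi_pmf I d r) (\<lambda>f. F (f(x := v)))" for v
  proof (rule insert.IH)
    fix y f assume y: "y \<in> I"
    then have twist: "f(y := w, x := v) = f(x := v, y := w)" for w
      using insert.hyps by (intro fun_upd_twist) auto
    show "measure_pmf.expectation (p y) (\<lambda>w. F (f(y := w, x := v)))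
            \<le> measure_pmf.expectation (r y) (\<lambda>w. F (f(y := w, x := v)))"
      unfolding twist using insert.prems(3)[of y "f(x := v)"] y by blast
  qed (use insert.prems in auto)
  have fin: "finite (set_pmf (Pi_pmf I d r))"
    using insert by (intro finite_set_Pi_pmf) auto
  have "measure_pmf.expectation (Pi_pmf (insert x I) d p) F =
        measure_pmf.expectation (p x) (\<lambda>v. measure_pmf.expectation (Pi_pmf I d p) (\<lambda>f. F (f(x := v))))"
    using insert by (intro expectation_Pi_pmf_insert) auto
  also have "\<dots> \<le> measure_pmf.expectation (p x) (\<lambda>v. measure_pmf.expectation (Pi_pmf I d r) (\<lambda>f. F (f(x := v))))"
    using insert.prems by (intro expectation_mono_finite IH) auto
  also have "\<dots> = measure_pmf.expectation (Pi_pmf I d r) (\<lambda>f. measure_pmf.expectation (p x) (\<lambda>v. F (f(x := v))))"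
    using insert.prems by (intro expectation_swap_finite fin) auto
  also have "\<dots> \<le> measure_pmf.expectation (Pi_pmf I d r) (\<lambda>f. measure_pmf.expectation (r x) (\<lambda>v. F (f(x := v))))"
    by (intro expectation_mono_finite fin insert.prems(3)) simp
  also have "\<dots> = measure_pmf.expectation (r x) (\<lambda>v. measure_pmf.expectation (Pi_pmf I d r) (\<lambda>f. F (f(x := v))))"
    using insert.prems by (intro expectation_swap_finite[symmetric] fin) auto
  also have "\<dots> = measure_pmf.expectation (Pi_pmf (insert x I) d r) F"
    using insert by (intro expectation_Pi_pmf_insert[symmetric]) auto
  finally show ?case .
qed

section \<open>Sparse random partial maps and planting\<close>

definition sparse_entry :: "'b set \<Rightarrow> real \<Rightarrow> 'b option pmf" where
  "sparse_entry C q =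
     bind_pmf (bernoulli_pmf q) (\<lambda>b. if b then map_pmf Some (pmf_of_set C) else return_pmf None)"

definition sparse_map :: "'a set \<Rightarrow> 'b set \<Rightarrow> real \<Rightarrow> ('a \<rightharpoonup> 'b) pmf" where
  "sparse_map I C q = Pi_pmf I None (\<lambda>_. sparse_entry C q)"

lemma finite_sparse_entry:
  assumes "finite C" "C \<noteq> {}"
  shows "finite (set_pmf (sparse_entry C q))"
  using assms by (auto simp: sparse_entry_def)

lemma finite_sparse_map:
  assumes "finite I" "finite C" "C \<noteq> {}"
  shows "finite (set_pmf (sparse_map I C q))"
  unfolding sparse_map_def using assms by (intro finite_set_Pi_pmf finite_sparse_entry)

lemma expectation_sparse_entry:
  fixes f :: "'b option \<Rightarrow> real"
  assumes "finite C" "C \<noteq> {}" "0 \<le> q" "q \<le> 1"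
  shows "measure_pmf.expectation (sparse_entry C q) f =
           (1 - q) * f None + q / card C * (\<Sum>c\<in>C. f (Some c))"
proof -
  have "measure_pmf.expectation (sparse_entry C q) f =
    measure_pmf.expectation (bernoulli_pmf q)
      (\<lambda>b. if b then measure_pmf.expectation (map_pmf Some (pmf_of_set C)) f else f None)"
    unfolding sparse_entry_def using assms
    by (subst expectation_bind_finite) (auto intro!: Bochner_Integration.integral_cong)
  also have "\<dots> = (1 - q) * f None + q / card C * (\<Sum>c\<in>C. f (Some c))"
    using assms by (simp add: integral_pmf_of_set)
  finally show ?thesis .
qed

lemma expectation_sparse_map_insert:
  fixes F :: "('a \<rightharpoonup> 'b) \<Rightarrow> real"
  assumes "finite I" "x \<notin> I" "finite C" "C \<noteq> {}" "0 \<le> q" "q \<le> 1"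
  shows "measure_pmf.expectation (sparse_map (insert x I) C q) F =
           (1 - q) * measure_pmf.expectation (sparse_map I C q) (\<lambda>W. F (W(x := None)))
           + q / card C * (\<Sum>c\<in>C. measure_pmf.expectation (sparse_map I C q) (\<lambda>W. F (W(x \<mapsto> c))))"
proof -
  have "measure_pmf.expectation (sparse_map (insert x I) C q) F =
    measure_pmf.expectation (sparse_entry C q)
      (\<lambda>y. measure_pmf.expectation (sparse_map I C q) (\<lambda>W. F (W(x := y))))"
    unfolding sparse_map_def
    using assms by (intro expectation_Pi_pmf_insert finite_sparse_entry) auto
  then show ?thesis
    using assms by (simp add: expectation_sparse_entry)
qed

text \<open>
  Overwriting the entry at \<open>x\<close> by \<open>c\<close> yields the law of the map conditioned on having \<open>c\<close> at \<open>x\<close>,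
  an event of probability \<open>q / card C\<close>; the entry that is overwritten is averaged out.
\<close>

lemma expectation_plant_entry:
  fixes F :: "('a \<rightharpoonup> 'b) \<Rightarrow> real"
  assumes "finite I" "x \<in> I" "finite C" "c \<in> C" "0 < q" "q \<le> 1"
  shows "measure_pmf.expectation (sparse_map I C q) (\<lambda>W. F (W(x \<mapsto> c))) =
           card C / q * measure_pmf.expectation (sparse_map I C q) (\<lambda>W. F W * of_bool (W x = Some c))"
proof -
  define J where "J = I - {x}"
  have I: "I = insert x J" and x: "x \<notin> J" and fin: "finite J"
    using assms by (auto simp: J_def)
  have C: "C \<noteq> {}" "card C > 0" using assms by (auto simp: card_gt_0_iff)
  note ins = expectation_sparse_map_insert[OF fin x assms(3) C(1) less_imp_le[OF assms(5)] assms(6)]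
  let ?E = "measure_pmf.expectation (sparse_map J C q) (\<lambda>W. F (W(x \<mapsto> c)))"
  have "(\<Sum>d\<in>C. measure_pmf.expectation (sparse_map J C q) (\<lambda>W. F (W(x \<mapsto> d)) * of_bool (d = c)))
      = (\<Sum>d\<in>C. if d = c then ?E else 0)"
    by (intro sum.cong) auto
  also have "\<dots> = ?E" using assms by simp
  finally have "measure_pmf.expectation (sparse_map I C q) (\<lambda>W. F W * of_bool (W x = Some c)) = q / card C * ?E"
    unfolding I ins by simp
  moreover have "measure_pmf.expectation (sparse_map I C q) (\<lambda>W. F (W(x \<mapsto> c))) = ?E"
    unfolding I ins using C by (simp add: field_simps)
  ultimately show ?thesis using assms C by simp
qed

text \<open>
  The change of measure for planting a whole partial map. Since \<open>W ++ T\<close> overwrites, the domain of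
  \<open>T\<close> may meet that of \<open>W\<close>, so that no case distinction on conflicting entries arises.
\<close>

lemma expectation_plant:
  fixes F :: "('a \<rightharpoonup> 'b) \<Rightarrow> real"
  assumes "finite I" "finite C" "0 < q" "q \<le> 1" "dom T \<subseteq> I" "ran T \<subseteq> C"
  shows "measure_pmf.expectation (sparse_map I C q) (\<lambda>W. F (W ++ T)) =
           (card C / q) ^ card (dom T) *
           measure_pmf.expectation (sparse_map I C q) (\<lambda>W. F W * of_bool (T \<subseteq>\<^sub>m W))"
proof -
  have "finite (dom T)" using assms finite_subset by blast
  then show ?thesis
    using assms(5,6)
  proof (induction "dom T" arbitrary: T F rule: finite_induct)
    case empty
    then have "T = Map.empty" by auto
    then show ?case by simp
  next
    case (insert x D)
    then obtain c where c: "T x = Some c" by blast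
    define T' where "T' = T(x := None)"
    have dom': "D = dom T'" using insert.hyps by (auto simp: T'_def)
    have T: "T = T'(x \<mapsto> c)" using c by (auto simp: T'_def)
    have xT': "T' x = None" by (simp add: T'_def)
    have ran': "ran T' \<subseteq> C" using insert.prems by (auto simp: T'_def ran_def)
    have cC: "c \<in> C" and xI: "x \<in> I" using insert.prems c by (auto intro: ranI)
    have card: "card (dom T) = Suc (card (dom T'))"
      using insert.hyps dom' by (metis card_insert_disjoint)
    have le: "T' \<subseteq>\<^sub>m W \<and> W x = Some c \<longleftrightarrow> T \<subseteq>\<^sub>m W" for W
      unfolding T using xT' by (auto simp: map_le_def dom_def)
    have upd: "T' \<subseteq>\<^sub>m W(x \<mapsto> c) \<longleftrightarrow> T' \<subseteq>\<^sub>m W" for W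
      using xT' unfolding map_le_def by (metis domIff fun_upd_other)
    have "measure_pmf.expectation (sparse_map I C q) (\<lambda>W. F (W ++ T)) =
          measure_pmf.expectation (sparse_map I C q) (\<lambda>W. F ((W ++ T')(x \<mapsto> c)))"
      unfolding T by simp
    also have "\<dots> = (card C / q) ^ card (dom T') *
       measure_pmf.expectation (sparse_map I C q) (\<lambda>W. F (W(x \<mapsto> c)) * of_bool (T' \<subseteq>\<^sub>m W))"
      by (rule insert.hyps(3)[OF dom' _ ran']) (use insert.prems in \<open>auto simp: T'_def\<close>)
    also have "(\<lambda>W. F (W(x \<mapsto> c)) * of_bool (T' \<subseteq>\<^sub>m W)) =
        (\<lambda>W. (\<lambda>W. F W * of_bool (T' \<subseteq>\<^sub>m W)) (W(x \<mapsto> c)))"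
      by (simp add: upd)
    also have "measure_pmf.expectation (sparse_map I C q) \<dots> = card C / q *
       measure_pmf.expectation (sparse_map I C q) (\<lambda>W. F W * of_bool (T' \<subseteq>\<^sub>m W) * of_bool (W x = Some c))"
      using expectation_plant_entry[of I x C c q "\<lambda>W. F W * of_bool (T' \<subseteq>\<^sub>m W)"] assms xI cC by simp
    also have "(\<lambda>W. F W * of_bool (T' \<subseteq>\<^sub>m W) * of_bool (W x = Some c)) =
        (\<lambda>W. F W * of_bool (T \<subseteq>\<^sub>m W))"
      by (auto simp: fun_eq_iff le[symmetric])
    finally show ?case unfolding card by simp
  qed
qed


section \<open>Fragments and their expected weight\<close>

definition partial_maps :: "'a set \<Rightarrow> 'b set \<Rightarrow> ('a \<rightharpoonup> 'b) set" where
  "partial_maps I C = {S. dom S \<subseteq> I \<and> ran S \<subseteq> C}"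

lemma finite_partial_maps:
  assumes "finite I" "finite C"
  shows "finite (partial_maps I C)"
proof -
  have "partial_maps I C \<subseteq> (\<Union>D\<in>Pow I. {S. dom S = D \<and> ran S \<subseteq> C})"
    by (auto simp: partial_maps_def)
  moreover have "finite \<dots>"
    using assms by (auto intro!: finite_set_of_finite_maps intro: finite_subset)
  ultimately show ?thesis by (rule finite_subset)
qed

lemma partial_maps_mono:
  assumes "S \<in> partial_maps I C" "T \<subseteq>\<^sub>m S"
  shows "T \<in> partial_maps I C"
proof -
  have "ran T \<subseteq> ran S"
    using assms(2) by (force simp: map_le_def ran_def dom_def)
  then show ?thesis
    using assms map_le_implies_dom_le[of T S] by (auto simp: partial_maps_def)
qed

lemma finite_submaps:
  assumes "finite (dom S)"
  shows "finite {T. T \<subseteq>\<^sub>m S}" "card {T. T \<subseteq>\<^sub>m S} \<le> 2 ^ card (dom S)"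
proof -
  have eq: "{T. T \<subseteq>\<^sub>m S} \<subseteq> (\<lambda>D. S |` D) ` Pow (dom S)"
  proof
    fix T assume "T \<in> {T. T \<subseteq>\<^sub>m S}"
    then have "T \<subseteq>\<^sub>m S" by simp
    then have "T = S |` dom T" "dom T \<subseteq> dom S"
      by (force simp: map_le_def restrict_map_def fun_eq_iff dom_def)+
    then show "T \<in> (\<lambda>D. S |` D) ` Pow (dom S)" by blast
  qed
  show "finite {T. T \<subseteq>\<^sub>m S}"
    by (rule finite_subset[OF eq]) (use assms in auto)
  have "card {T. T \<subseteq>\<^sub>m S} \<le> card ((\<lambda>D. S |` D) ` Pow (dom S))"
    by (rule card_mono[OF _ eq]) (use assms in auto)
  also have "\<dots> \<le> card (Pow (dom S))"
    by (rule card_image_le) (use assms in auto)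
  finally show "card {T. T \<subseteq>\<^sub>m S} \<le> 2 ^ card (dom S)"
    using assms by (simp add: card_Pow)
qed

text \<open>
  Stated pointwise, because the union of two partial maps need not be a partial map.
\<close>

definition in_union :: "('a \<rightharpoonup> 'b) \<Rightarrow> ('a \<rightharpoonup> 'b) \<Rightarrow> ('a \<rightharpoonup> 'b) \<Rightarrow> bool" where
  "in_union R W S \<longleftrightarrow> (\<forall>x\<in>dom R. R x = W x \<or> R x = S x)"

definition residue :: "('a \<rightharpoonup> 'b) \<Rightarrow> ('a \<rightharpoonup> 'b) \<Rightarrow> ('a \<rightharpoonup> 'b)" where
  "residue W R = R |` {x. R x \<noteq> W x}"

definition fragment :: "('a \<rightharpoonup> 'b) set \<Rightarrow> ('a \<rightharpoonup> 'b) \<Rightarrow> ('a \<rightharpoonup> 'b) \<Rightarrow> ('a \<rightharpoonup> 'b)" where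
  "fragment H W S =
     residue W (ARG_MIN (\<lambda>R. card (dom (residue W R))) R. R \<in> H \<and> in_union R W S)"

lemma residue_le_iff: "residue W R \<subseteq>\<^sub>m V \<longleftrightarrow> in_union R W V"
  by (auto simp: residue_def in_union_def map_le_def restrict_map_def dom_def split: if_splits)

lemma fragment_minimal:
  assumes "S \<in> H"
  shows "\<exists>R\<in>H. in_union R W S \<and> fragment H W S = residue W R \<and>
           (\<forall>R'\<in>H. in_union R' W S \<longrightarrow> card (dom (residue W R)) \<le> card (dom (residue W R')))"
proof -
  let ?P = "\<lambda>R. R \<in> H \<and> in_union R W S"
  let ?R = "ARG_MIN (\<lambda>R. card (dom (residue W R))) R. R \<in> H \<and> in_union R W S"
  have S: "?P S" using assms by (auto simp: in_union_def)
  have "?P ?R" by (rule arg_min_natI[of ?P, OF S])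
  moreover have "card (dom (residue W ?R)) \<le> card (dom (residue W R'))" if "?P R'" for R'
    by (rule arg_min_nat_le[of ?P, OF that])
  ultimately show ?thesis
    unfolding fragment_def by (intro bexI[of _ ?R] conjI ballI impI refl) simp_all
qed

lemma fragment_le:
  assumes "S \<in> H"
  shows "fragment H W S \<subseteq>\<^sub>m S"
  using fragment_minimal[OF assms, of W] by (auto simp: residue_le_iff)

lemma fragment_completes:
  assumes "S \<in> H" "fragment H W S \<subseteq>\<^sub>m V"
  shows "\<exists>R\<in>H. in_union R W V"
  using fragment_minimal[OF assms(1), of W] assms(2) by (auto simp: residue_le_iff)

text \<open>
  The heart of the Park--Pham argument: any target \<open>R\<close> found in \<open>W ++ T\<close> contains the fragment
  \<open>T\<close>. For \<open>R\<close> lies in the union of \<open>W\<close> and \<open>S\<close>, and what it lacks from \<open>W\<close> is contained in \<open>T\<close>;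
  minimality of \<open>T\<close> forces equality. Hence \<open>T\<close> is one of only \<open>2 ^ card (dom R)\<close> submaps of a
  target that can be read off from \<open>W ++ T\<close> alone.
\<close>

lemma fragment_recovered:
  assumes S: "S \<in> H" and T: "T = fragment H W S" and fin: "finite (dom S)"
  shows "\<exists>R\<in>H. R \<subseteq>\<^sub>m W ++ T"
    and "R \<in> H \<Longrightarrow> R \<subseteq>\<^sub>m W ++ T \<Longrightarrow> T \<subseteq>\<^sub>m R"
proof -
  obtain Q where Q: "Q \<in> H" "in_union Q W S" "T = residue W Q"
    and min: "\<And>R'. R' \<in> H \<Longrightarrow> in_union R' W S \<Longrightarrow> card (dom T) \<le> card (dom (residue W R'))"
    using fragment_minimal[OF S, of W] T by auto
  have TS: "T \<subseteq>\<^sub>m S" using fragment_le[OF S] T by simp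
  have "Q \<subseteq>\<^sub>m W ++ T"
    unfolding Q(3) by (auto simp: map_le_def map_add_def residue_def restrict_map_def dom_def split: option.splits)
  then show "\<exists>R\<in>H. R \<subseteq>\<^sub>m W ++ T" using Q by blast
  assume R: "R \<in> H" "R \<subseteq>\<^sub>m W ++ T"
  have sub: "residue W R \<subseteq>\<^sub>m T"
    unfolding residue_le_iff in_union_def
    using R(2) by (auto simp: map_le_def map_add_def split: option.splits)
  then have "in_union R W S"
    using TS map_le_trans residue_le_iff by metis
  then have le: "card (dom T) \<le> card (dom (residue W R))" using min R by blast
  have finT: "finite (dom T)" using TS fin map_le_implies_dom_le finite_subset by metis
  have "dom (residue W R) = dom T"
    using card_seteq[OF finT map_le_implies_dom_le[OF sub] le] .
  then have "T = residue W R"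
    using sub by (metis map_le_antisym map_le_def)
  then show "T \<subseteq>\<^sub>m R" by (simp add: residue_def map_le_def restrict_map_def dom_def)
qed

definition weight :: "real \<Rightarrow> ('a \<rightharpoonup> 'b) set \<Rightarrow> real" where
  "weight p U = (\<Sum>T\<in>U. p ^ card (dom T))"

definition large_fragments :: "('a \<rightharpoonup> 'b) set \<Rightarrow> nat \<Rightarrow> ('a \<rightharpoonup> 'b) \<Rightarrow> ('a \<rightharpoonup> 'b) set" where
  "large_fragments H k W = {T \<in> fragment H W ` H. k < card (dom T)}"

text \<open>
  Exchange the sum over \<open>T\<close> with the expectation and plant \<open>T\<close>. Each planted entry costs a factor
  \<open>card C / q\<close> and weighs \<open>p\<close>, together at most \<open>1 / L\<close>; after planting, at most \<open>2 ^ l\<close> maps \<open>T\<close>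
  remain possible for each outcome, by \<open>fragment_recovered\<close>.
\<close>

lemma expected_weight_large_fragments:
  fixes p q L :: real
  assumes fin: "finite I" "finite C" "C \<noteq> {}" and q: "0 < q" "q \<le> 1"
    and H: "H \<subseteq> partial_maps I C" "\<And>S. S \<in> H \<Longrightarrow> card (dom S) \<le> l"
    and p: "0 \<le> p" and L: "1 \<le> L" "p * card C * L \<le> q"
  shows "measure_pmf.expectation (sparse_map I C q) (\<lambda>W. weight p (large_fragments H k W))
           \<le> 2 ^ l / L ^ (k + 1)"
proof -
  let ?M = "partial_maps I C"
  let ?E = "measure_pmf.expectation (sparse_map I C q)"
  (* f picks a target from the planted map only; g relaxes the event that T is a large fragment
     of W to a condition on T and the planted map W ++ T *)
  define f where "f = (\<lambda>Z. SOME R. R \<in> H \<and> R \<subseteq>\<^sub>m Z)"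
  define g :: "('a \<rightharpoonup> 'b) \<Rightarrow> ('a \<rightharpoonup> 'b) \<Rightarrow> real" where
    "g = (\<lambda>T Z. of_bool (k < card (dom T) \<and> (\<exists>R\<in>H. R \<subseteq>\<^sub>m Z) \<and> T \<subseteq>\<^sub>m f Z))"
  note finM = finite_partial_maps[OF fin(1,2)]
  note finp = finite_sparse_map[OF fin, of q]
  have finH: "finite (dom S)" if "S \<in> H" for S
    using H(1) that fin(1) by (auto simp: partial_maps_def intro: finite_subset)
  have sub: "large_fragments H k W \<subseteq> ?M" for W
  proof
    fix T assume "T \<in> large_fragments H k W"
    then obtain S where "S \<in> H" "T \<subseteq>\<^sub>m S"
      using fragment_le unfolding large_fragments_def by blast
    then show "T \<in> ?M" using H(1) partial_maps_mono by blast
  qed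
  have f: "f Z \<in> H \<and> f Z \<subseteq>\<^sub>m Z" if "\<exists>R\<in>H. R \<subseteq>\<^sub>m Z" for Z
    using that someI_ex[of "\<lambda>R. R \<in> H \<and> R \<subseteq>\<^sub>m Z"] by (auto simp: f_def)
  have g: "of_bool (T \<in> large_fragments H k W) \<le> g T (W ++ T)" for T W
  proof (cases "T \<in> large_fragments H k W")
    case True
    then obtain S where S: "S \<in> H" "T = fragment H W S" "k < card (dom T)"
      by (auto simp: large_fragments_def)
    note rec = fragment_recovered[OF S(1,2) finH[OF S(1)]]
    show ?thesis using rec(1) rec(2)[of "f (W ++ T)"] f[OF rec(1)] S(3) by (simp add: g_def)
  qed (simp add: g_def)
  have ratio: "p * (card C / q) \<le> 1 / L"
    using L q by (simp add: field_simps)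
  have term_le: "p ^ card (dom T) * ?E (\<lambda>W. of_bool (T \<in> large_fragments H k W))
      \<le> 1 / L ^ (k + 1) * ?E (g T)" if T: "T \<in> ?M" for T
  proof (cases "k < card (dom T)")
    case True
    have "?E (\<lambda>W. of_bool (T \<in> large_fragments H k W)) \<le> ?E (\<lambda>W. g T (W ++ T))"
      using g by (intro expectation_mono_finite finp)
    also have "\<dots> = (card C / q) ^ card (dom T) * ?E (\<lambda>W. g T W * of_bool (T \<subseteq>\<^sub>m W))"
      using T fin q by (intro expectation_plant) (auto simp: partial_maps_def)
    also have "?E (\<lambda>W. g T W * of_bool (T \<subseteq>\<^sub>m W)) \<le> ?E (g T)"
      by (intro expectation_mono_finite finp) (simp add: g_def)
    finally have "?E (\<lambda>W. of_bool (T \<in> large_fragments H k W)) \<le> (card C / q) ^ card (dom T) * ?E (g T)"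
      using q by (simp add: mult_left_mono)
    then have "p ^ card (dom T) * ?E (\<lambda>W. of_bool (T \<in> large_fragments H k W))
        \<le> p ^ card (dom T) * ((card C / q) ^ card (dom T) * ?E (g T))"
      using p by (intro mult_left_mono) auto
    also have "\<dots> = (p * (card C / q)) ^ card (dom T) * ?E (g T)"
      by (simp only: power_mult_distrib mult.assoc)
    also have "\<dots> \<le> (1 / L) ^ card (dom T) * ?E (g T)"
      using ratio p q by (intro mult_right_mono power_mono Bochner_Integration.integral_nonneg) (auto simp: g_def)
    also have "\<dots> \<le> (1 / L) ^ (k + 1) * ?E (g T)"
      using L True by (intro mult_right_mono power_decreasing Bochner_Integration.integral_nonneg) (auto simp: g_def)
    finally show ?thesis by (simp add: power_one_over)
  next
    case False
    then show ?thesis by (simp add: large_fragments_def g_def)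
  qed
  have "?E (\<lambda>W. weight p (large_fragments H k W))
      = ?E (\<lambda>W. \<Sum>T\<in>?M. p ^ card (dom T) * of_bool (T \<in> large_fragments H k W))"
    unfolding weight_def using sub finM
    by (intro Bochner_Integration.integral_cong refl sum.mono_neutral_cong_left) auto
  also have "\<dots> = (\<Sum>T\<in>?M. p ^ card (dom T) * ?E (\<lambda>W. of_bool (T \<in> large_fragments H k W)))"
    by (subst Bochner_Integration.integral_sum) (auto intro!: integrable_measure_pmf_finite finp)
  also have "\<dots> \<le> (\<Sum>T\<in>?M. 1 / L ^ (k + 1) * ?E (g T))"
    by (intro sum_mono term_le)
  also have "\<dots> = 1 / L ^ (k + 1) * ?E (\<lambda>Z. \<Sum>T\<in>?M. g T Z)"
    by (subst Bochner_Integration.integral_sum)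
       (auto intro!: integrable_measure_pmf_finite finp simp: sum_distrib_left)
  also have "\<dots> \<le> 1 / L ^ (k + 1) * ?E (\<lambda>Z. 2 ^ l)"
  proof (intro mult_left_mono expectation_mono_finite finp)
    fix Z
    show "(\<Sum>T\<in>?M. g T Z) \<le> 2 ^ l"
    proof (cases "\<exists>R\<in>H. R \<subseteq>\<^sub>m Z")
      case True
      note fZ = f[OF True]
      have "(\<Sum>T\<in>?M. g T Z) \<le> (\<Sum>T\<in>?M. of_bool (T \<subseteq>\<^sub>m f Z))"
        by (intro sum_mono) (simp add: g_def)
      also have "\<dots> = card {T \<in> ?M. T \<subseteq>\<^sub>m f Z}"
        using finM by (simp add: Int_def)
      also have "\<dots> \<le> card {T. T \<subseteq>\<^sub>m f Z}"
        using fZ finH by (intro of_nat_mono card_mono finite_submaps(1)) auto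
      also have "\<dots> \<le> 2 ^ card (dom (f Z))"
        using finite_submaps(2)[of "f Z"] fZ finH by (metis of_nat_le_numeral_power_cancel_iff)
      also have "\<dots> \<le> 2 ^ l"
        using H(2) fZ by (intro power_increasing) auto
      finally show ?thesis .
    next
      case False
      then show ?thesis by (simp add: g_def)
    qed
  qed (use L in simp)
  finally show ?thesis by simp
qed

section \<open>Merging two rounds\<close>

definition miss :: "'a set \<Rightarrow> 'b set \<Rightarrow> ('a \<rightharpoonup> 'b) set \<Rightarrow> real \<Rightarrow> real" where
  "miss I C H q = measure_pmf.expectation (sparse_map I C q) (\<lambda>W. of_bool (\<not> (\<exists>S\<in>H. S \<subseteq>\<^sub>m W)))"


text \<open>
  One coordinate of the merging. Here \<open>F X\<close> says that no target is met when the symbols in \<open>X\<close> are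
  on offer at the coordinate; it is multiplicative since a target uses at most one of them. With
  \<open>s\<close> the fraction of useless symbols, the claim reads
  \<open>1 - (a + b) * (1 - s) \<le> (1 - a * (1 - s)) * (1 - b * (1 - s))\<close> if \<open>F {} = 1\<close>; otherwise both
  sides vanish.
\<close>

lemma merge_rounds_entry:
  fixes F :: "'b set \<Rightarrow> real"
  assumes C: "finite C" "C \<noteq> {}" and ab: "0 \<le> a" "0 \<le> b" "a + b \<le> 1"
    and F: "\<And>X. F X = 0 \<or> F X = 1" "\<And>X Y. F (X \<union> Y) = F X * F Y"
  shows "measure_pmf.expectation (map_pmf set_option (sparse_entry C (a + b))) F
      \<le> measure_pmf.expectation (bind_pmf (sparse_entry C a)
          (\<lambda>u. map_pmf (\<lambda>v. set_option u \<union> set_option v) (sparse_entry C b))) F"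
proof -
  define s where "s = (\<Sum>c\<in>C. F {c}) / card C"
  have cardC: "real (card C) > 0" using C by (simp add: card_gt_0_iff)
  have sumF: "(\<Sum>c\<in>C. F {c}) = card C * s" using cardC by (simp add: s_def)
  have "(\<Sum>c\<in>C. F {c}) \<le> (\<Sum>c\<in>C. 1)"
    by (intro sum_mono) (metis F(1) order.refl zero_le_one)
  then have s: "s \<le> 1" using cardC by (simp add: s_def)
  have E1: "measure_pmf.expectation (map_pmf set_option (sparse_entry C (a + b))) F
      = (1 - (a + b)) * F {} + (a + b) * s"
    using C ab cardC by (simp add: expectation_sparse_entry sumF)
  have inner: "measure_pmf.expectation (sparse_entry C b) (\<lambda>v. F (X \<union> set_option v))
      = F X * ((1 - b) * F {} + b * s)" for X
    using C ab cardC
    by (simp add: expectation_sparse_entry F(2) sum_distrib_left[symmetric] sumF field_simps del: Un_insert_right)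
  have outer: "measure_pmf.expectation (sparse_entry C a) (\<lambda>u. F (set_option u) * t)
      = ((1 - a) * F {} + a * s) * t" for t
    using C ab cardC
    by (simp add: expectation_sparse_entry sum_distrib_right[symmetric] sumF)
  have "measure_pmf.expectation (bind_pmf (sparse_entry C a)
          (\<lambda>u. map_pmf (\<lambda>v. set_option u \<union> set_option v) (sparse_entry C b))) F =
        measure_pmf.expectation (sparse_entry C a) (\<lambda>u. F (set_option u) * ((1 - b) * F {} + b * s))"
    using finite_sparse_entry[OF C] by (subst expectation_bind_finite) (auto simp: inner)
  also have "\<dots> = ((1 - a) * F {} + a * s) * ((1 - b) * F {} + b * s)"
    by (rule outer)
  finally have E2: "measure_pmf.expectation (bind_pmf (sparse_entry C a)
          (\<lambda>u. map_pmf (\<lambda>v. set_option u \<union> set_option v) (sparse_entry C b))) F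
      = ((1 - a) * F {} + a * s) * ((1 - b) * F {} + b * s)" .
  show ?thesis
  proof (cases "F {} = 0")
    case True
    then have "F {c} = 0" for c using F(2)[of "{}" "{c}"] by simp
    then have "s = 0" by (simp add: s_def)
    then show ?thesis unfolding E1 E2 using True by simp
  next
    case False
    then have "F {} = 1" using F(1)[of "{}"] by auto
    moreover have "0 \<le> a * b * (1 - s)\<^sup>2" using ab by simp
    ultimately show ?thesis unfolding E1 E2 by (simp add: algebra_simps power2_eq_square)
  qed
qed

text \<open>
  Both sides become products over positions of random sets of symbols on offer: the entry itself
  on the left, and the at most two entries of the independent rounds on the right. Then the
  coordinatewise comparison applies.
\<close>

lemma miss_merge_rounds:
  assumes fin: "finite I" "finite C" "C \<noteq> {}" and ab: "0 \<le> a" "0 \<le> b" "a + b \<le> 1"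
    and H: "H \<subseteq> partial_maps I C"
  shows "miss I C H (a + b) \<le>
    measure_pmf.expectation (sparse_map I C a) (\<lambda>W.
      measure_pmf.expectation (sparse_map I C b) (\<lambda>V. of_bool (\<not> (\<exists>S\<in>H. in_union S W V))))"
proof -
  define F :: "('a \<Rightarrow> 'b set) \<Rightarrow> real" where
    "F = (\<lambda>f. of_bool (\<not> (\<exists>S\<in>H. \<forall>x\<in>dom S. the (S x) \<in> f x)))"
  let ?one = "\<lambda>_::'a. map_pmf set_option (sparse_entry C (a + b))"
  let ?two = "\<lambda>_::'a. bind_pmf (sparse_entry C a)
                (\<lambda>u. map_pmf (\<lambda>v. set_option u \<union> set_option v) (sparse_entry C b))"
  have one: "Pi_pmf I {} ?one = map_pmf (\<lambda>W. set_option \<circ> W) (sparse_map I C (a + b))"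
    unfolding sparse_map_def using fin by (intro Pi_pmf_map) auto
  have "Pi_pmf I {} (\<lambda>x. map_pmf (\<lambda>v. set_option (W x) \<union> set_option v) (sparse_entry C b)) =
      map_pmf (\<lambda>V x. if x \<in> I then set_option (W x) \<union> set_option (V x) else {}) (sparse_map I C b)"
    for W :: "'a \<rightharpoonup> 'b"
    unfolding map_pmf_def sparse_map_def using fin by (subst Pi_pmf_bind[where d' = None]) auto
  then have two: "Pi_pmf I {} ?two =
      bind_pmf (sparse_map I C a) (\<lambda>W.
        map_pmf (\<lambda>V x. if x \<in> I then set_option (W x) \<union> set_option (V x) else {}) (sparse_map I C b))"
    unfolding sparse_map_def using fin by (subst Pi_pmf_bind[where d' = None]) simp_all
  have F1: "F (set_option \<circ> W) = of_bool (\<not> (\<exists>S\<in>H. S \<subseteq>\<^sub>m W))" for W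
  proof -
    have "(\<forall>x\<in>dom S. the (S x) \<in> (set_option \<circ> W) x) \<longleftrightarrow> S \<subseteq>\<^sub>m W" for S
      unfolding map_le_def by (intro ball_cong) auto
    then show ?thesis by (simp only: F_def)
  qed
  have F2: "F (\<lambda>x. if x \<in> I then set_option (W x) \<union> set_option (V x) else {}) =
      of_bool (\<not> (\<exists>S\<in>H. in_union S W V))" for W V
  proof -
    have "(\<forall>x\<in>dom S. the (S x) \<in> (if x \<in> I then set_option (W x) \<union> set_option (V x) else {}))
        \<longleftrightarrow> in_union S W V" if "S \<in> H" for S
    proof -
      have "dom S \<subseteq> I" using that H by (auto simp: partial_maps_def)
      then show ?thesis unfolding in_union_def by (intro ball_cong) auto
    qed
    then show ?thesis by (simp only: F_def cong: bex_cong)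
  qed
  have step: "measure_pmf.expectation (?one x) (\<lambda>X. F (f(x := X)))
      \<le> measure_pmf.expectation (?two x) (\<lambda>X. F (f(x := X)))" for f x
  proof (rule merge_rounds_entry)
    have Fin: "(\<forall>y\<in>dom S. the (S y) \<in> (f(x := X)) y) \<longleftrightarrow>
        (x \<in> dom S \<longrightarrow> the (S x) \<in> X) \<and> (\<forall>y\<in>dom S - {x}. the (S y) \<in> f y)" for S X
      by auto
    show "F (f(x := X)) = 0 \<or> F (f(x := X)) = 1" for X by (simp add: F_def of_bool_def)
    show "F (f(x := X \<union> Y)) = F (f(x := X)) * F (f(x := Y))" for X Y
      unfolding F_def Fin by auto
  qed (use assms in auto)
  have "miss I C H (a + b) = measure_pmf.expectation (Pi_pmf I {} ?one) F"
    unfolding one miss_def by (simp add: F1)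
  also have "\<dots> \<le> measure_pmf.expectation (Pi_pmf I {} ?two) F"
    using fin finite_sparse_entry[OF fin(2,3)] by (intro expectation_Pi_pmf_mono step) auto
  also have "\<dots> = measure_pmf.expectation (sparse_map I C a) (\<lambda>W.
      measure_pmf.expectation (sparse_map I C b) (\<lambda>V. of_bool (\<not> (\<exists>S\<in>H. in_union S W V))))"
    unfolding two using finite_sparse_map[OF fin]
    by (subst expectation_bind_finite) (auto simp: F2)
  finally show ?thesis .
qed


section \<open>The iteration over rounds\<close>

definition covers :: "('a \<rightharpoonup> 'b) set \<Rightarrow> ('a \<rightharpoonup> 'b) set \<Rightarrow> bool" where
  "covers U H \<longleftrightarrow> (\<forall>S\<in>H. \<exists>T\<in>U. T \<subseteq>\<^sub>m S)"

text \<open>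
  The density of all rounds together, in units of \<open>p * card C\<close>, when targets have size at most
  \<open>l\<close>. The summand \<open>16 * x / l\<close> spends more on small targets, where the bound
  \<open>2 ^ l / L ^ (l div 2 + 1)\<close> is weak for constant \<open>L\<close>.
\<close>

fun total_rate :: "real \<Rightarrow> nat \<Rightarrow> real" where
  "total_rate x l = (if l = 0 then 0 else 16 * (1 + x / l) + total_rate x (l div 2))"

declare total_rate.simps [simp del]

lemma total_rate_nonneg: "0 \<le> x \<Longrightarrow> 0 \<le> total_rate x l"
proof (induction l rule: less_induct)
  case (less l)
  then show ?case
    by (subst total_rate.simps) (auto intro!: add_nonneg_nonneg)
qed

text \<open>
  The term \<open>16 * x / l\<close> is subtracted to make the induction close: halving \<open>l\<close> at least doubles
  \<open>x / l\<close>, so the subtracted terms telescope and the sum of all the \<open>16 * x / l\<close> stays below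
  \<open>32 * x\<close>.
\<close>

lemma total_rate_le:
  assumes "0 \<le> x" "l > 0"
  shows "total_rate x l \<le> 16 * (1 + log 2 l) + 32 * x - 16 * x / l"
  using assms(2)
proof (induction l rule: less_induct)
  case (less l)
  show ?case
  proof (cases "l = 1")
    case True
    then show ?thesis by (simp add: total_rate.simps[of x "Suc 0"] total_rate.simps[of x 0])
  next
    case False
    let ?k = "l div 2"
    have k: "0 < ?k" "?k < l" "2 * ?k \<le> l" using False less.prems by auto
    have "log 2 ?k + 1 = log 2 (2 * ?k)" using k by (simp add: log_mult)
    also have "\<dots> \<le> log 2 l" using k by (intro log_mono) (auto simp flip: of_nat_mult)
    finally have lg: "log 2 ?k \<le> log 2 l - 1" by simp
    have "real (2 * ?k) \<le> real l" using k(3) of_nat_le_iff by blast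
    then have fr: "2 * (x / l) \<le> x / ?k"
      using k assms(1) less.prems by (simp add: field_simps mult_left_mono)
    have "total_rate x l = 16 * (1 + x / l) + total_rate x ?k"
      using less.prems by (simp add: total_rate.simps[of x l])
    also have "\<dots> \<le> 16 * (1 + x / l) + (16 * (1 + log 2 ?k) + 32 * x - 16 * x / ?k)"
      using less.IH[OF k(2,1)] by simp
    also have "\<dots> \<le> 16 * (1 + log 2 l) + 32 * x - 16 * x / l"
    proof -
      have "16 * x / l = 16 * (x / l)" "16 * x / ?k = 16 * (x / ?k)" by simp_all
      then show ?thesis using lg fr by argo
    qed
    finally show ?thesis .
  qed
qed

text \<open>
  By Bernoulli's inequality \<open>(1 + x / l) ^ l \<ge> 1 + x\<close>. This is why the choice of densities makes
  the error of \<^emph>\<open>every\<close> round small when \<open>x\<close> is large, while the factor \<open>1 / 2 ^ l\<close> keeps the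
  errors summable over the rounds.
\<close>

lemma round_cost:
  fixes x :: real
  assumes "0 \<le> x" "l > 0"
  shows "2 ^ l / (16 * (1 + x / l)) ^ (l div 2 + 1) \<le> 1 / (2 ^ l * sqrt (1 + x))"
proof -
  let ?L = "16 * (1 + x / l)"
  have L: "1 \<le> ?L" using assms by (simp add: field_simps)
  have "4 ^ l * sqrt (1 + x) \<le> ?L ^ (l div 2 + 1)"
  proof (rule power2_le_imp_le)
    have "1 + x \<le> (1 + x / l) ^ l"
      using Bernoulli_inequality[of "x / l" l] assms by (simp add: order_trans[of "-1" 0])
    then have "16 ^ l * (1 + x) \<le> ?L ^ l"
      by (simp only: power_mult_distrib mult_left_mono zero_le_power zero_le_numeral)
    also have "\<dots> \<le> ?L ^ (2 * (l div 2 + 1))"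
      by (intro power_increasing L) presburger
    finally have "16 ^ l * (1 + x) \<le> (?L ^ (l div 2 + 1))\<^sup>2"
      by (simp only: power_even_eq)
    moreover have "(4 ^ l * sqrt (1 + x))\<^sup>2 = 16 ^ l * (1 + x)"
    proof -
      have "((4::real) ^ l)\<^sup>2 = 16 ^ l"
        unfolding power2_eq_square power_mult_distrib[symmetric] by simp
      then show ?thesis using assms by (simp add: power_mult_distrib)
    qed
    ultimately show "(4 ^ l * sqrt (1 + x))\<^sup>2 \<le> (?L ^ (l div 2 + 1))\<^sup>2" by simp
  qed (use L in simp)
  moreover have "(2::real) ^ l * 2 ^ l = 4 ^ l" by (simp flip: power_mult_distrib)
  ultimately have "2 ^ l * (2 ^ l * sqrt (1 + x)) \<le> ?L ^ (l div 2 + 1)"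
    by (simp only: mult.assoc[symmetric])
  moreover have "0 < ?L ^ (l div 2 + 1)" using L by (intro zero_less_power) linarith
  moreover have "0 < 2 ^ l * sqrt (1 + x)" using assms by simp
  ultimately show ?thesis by (simp add: divide_simps mult.commute del: power_Suc power_add)
qed

lemma weight_nonneg: "0 \<le> p \<Longrightarrow> 0 \<le> weight p U"
  by (simp add: weight_def sum_nonneg)

lemma weight_Un_le:
  assumes "finite U" "finite V" "0 \<le> p"
  shows "weight p (U \<union> V) \<le> weight p U + weight p V"
proof -
  have "weight p (U \<union> V) + weight p (U \<inter> V) = weight p U + weight p V"
    unfolding weight_def using assms by (intro sum.union_inter)
  then show ?thesis using weight_nonneg[OF assms(3), of "U \<inter> V"] by linarith
qed

lemma miss_nonneg: "0 \<le> miss I C H q"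
  unfolding miss_def by (intro Bochner_Integration.integral_nonneg) simp

lemma miss_le_1:
  assumes "finite I" "finite C" "C \<noteq> {}"
  shows "miss I C H q \<le> 1"
proof -
  have "miss I C H q \<le> measure_pmf.expectation (sparse_map I C q) (\<lambda>_. 1)"
    unfolding miss_def using finite_sparse_map[OF assms] by (intro expectation_mono_finite) auto
  then show ?thesis by simp
qed

text \<open>
  Markov's inequality for the weight of the cover by large fragments, arranged as an induction on
  \<open>l\<close>. If every cover of \<open>H\<close> weighs at least \<open>c\<close>, then every cover of the small fragments weighs
  at least \<open>c\<close> minus the weight of the large ones, because both together cover \<open>H\<close>. The induction
  hypothesis therefore needs \<open>c\<close> to be arbitrary, even negative.
\<close>

lemma miss_le_of_covers_heavy:
  fixes p x c :: real
  assumes fin: "finite I" "finite C" "C \<noteq> {}" and p: "0 < p" and x: "0 \<le> x"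
    and rate: "p * card C * total_rate x l \<le> 1"
    and H: "H \<subseteq> partial_maps I C" "\<And>S. S \<in> H \<Longrightarrow> card (dom S) \<le> l"
    and c: "\<And>U. U \<subseteq> partial_maps I C \<Longrightarrow> covers U H \<Longrightarrow> c \<le> weight p U"
  shows "c * miss I C H (p * card C * total_rate x l) \<le> (1 - 1 / 2 ^ l) / sqrt (1 + x)"
  using rate H c
proof (induction l arbitrary: H c rule: less_induct)
  case (less l)
  let ?M = "partial_maps I C"
  have cardC: "real (card C) > 0" using fin by (simp add: card_gt_0_iff)
  show ?case
  proof (cases "l = 0 \<or> c \<le> 0")
    case True
    have "c * miss I C H (p * card C * total_rate x l) \<le> 0"
    proof (cases "c \<le> 0")
      case True
      then show ?thesis by (simp add: mult_nonpos_nonneg miss_nonneg)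
    next
      case False
      then have "H \<noteq> {}" using less.prems(4)[of "{}"] by (auto simp: covers_def weight_def)
      then obtain S where S: "S \<in> H" by blast
      moreover have "finite (dom S)" using S less.prems(2) fin(1)
        by (auto simp: partial_maps_def intro: finite_subset)
      ultimately have "S = Map.empty"
        using less.prems(3)[OF S] True False by simp
      then have "miss I C H (p * card C * total_rate x l) = 0"
        unfolding miss_def using S by (auto intro!: integral_eq_zero_AE AE_I2 bexI[of _ S])
      then show ?thesis by simp
    qed
    also have "0 \<le> (1 - 1 / 2 ^ l) / sqrt (1 + x)"
      using x by (intro divide_nonneg_nonneg) auto
    finally show ?thesis .
  next
    case False
    then have l: "l > 0" and cpos: "0 < c" by auto
    let ?k = "l div 2"
    define L where "L = 16 * (1 + x / l)"
    define a where "a = p * card C * L"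
    define b where "b = p * card C * total_rate x ?k"
    let ?E = "measure_pmf.expectation (sparse_map I C a)"
    have L: "1 \<le> L" using x l by (simp add: L_def field_simps)
    have rate_eq: "p * card C * total_rate x l = a + b"
      using l by (simp add: a_def b_def L_def total_rate.simps[of x l] ring_distribs)
    have a: "0 < a" unfolding a_def using p cardC L by simp
    have b: "0 \<le> b" unfolding b_def using p x by (simp add: total_rate_nonneg)
    have ab: "a + b \<le> 1" using less.prems(1) rate_eq by simp
    note finp = finite_sparse_map[OF fin, of a]
    note finM = finite_partial_maps[OF fin(1,2)]
    define small where "small W = {T \<in> fragment H W ` H. card (dom T) \<le> ?k}" for W
    have frag_M: "fragment H W ` H \<subseteq> ?M" for W
    proof
      fix T assume "T \<in> fragment H W ` H"
      then obtain S where "S \<in> H" "T = fragment H W S" by blast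
      then have "S \<in> H" "T \<subseteq>\<^sub>m S" using fragment_le[of S H W] by simp_all
      then show "T \<in> ?M" using less.prems(2) partial_maps_mono by blast
    qed
    then have sub_M: "small W \<subseteq> ?M" "large_fragments H ?k W \<subseteq> ?M" for W
      unfolding small_def large_fragments_def by blast+
    have second: "c * miss I C (small W) b
        \<le> weight p (large_fragments H ?k W) + (1 - 1 / 2 ^ ?k) / sqrt (1 + x)" for W
    proof -
      let ?w = "weight p (large_fragments H ?k W)"
      have "(c - ?w) * miss I C (small W) b \<le> (1 - 1 / 2 ^ ?k) / sqrt (1 + x)"
        unfolding b_def
      proof (rule less.IH)
        show "?k < l" using l by simp
        show "p * card C * total_rate x ?k \<le> 1" using ab a unfolding b_def by linarith
        show "small W \<subseteq> ?M" by (rule sub_M)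
        show "card (dom S) \<le> ?k" if "S \<in> small W" for S using that by (simp add: small_def)
      next
        fix U assume U: "U \<subseteq> ?M" "covers U (small W)"
        have "covers (large_fragments H ?k W \<union> U) H"
          unfolding covers_def
        proof
          fix S assume S: "S \<in> H"
          let ?T = "fragment H W S"
          show "\<exists>T\<in>large_fragments H ?k W \<union> U. T \<subseteq>\<^sub>m S"
          proof (cases "?k < card (dom ?T)")
            case True
            then have "?T \<in> large_fragments H ?k W" using S by (simp add: large_fragments_def)
            then show ?thesis using fragment_le[OF S] by blast
          next
            case False
            then have "?T \<in> small W" using S by (simp add: small_def)
            then obtain T where "T \<in> U" "T \<subseteq>\<^sub>m ?T" using U(2) by (auto simp: covers_def)
            then show ?thesis using fragment_le[OF S] map_le_trans by blast
          qed
        qed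
        then have "c \<le> weight p (large_fragments H ?k W \<union> U)"
          using U(1) sub_M by (intro less.prems(4)) auto
        also have "\<dots> \<le> ?w + weight p U"
          using p finite_subset[OF sub_M(2) finM] finite_subset[OF U(1) finM]
          by (intro weight_Un_le) auto
        finally show "c - ?w \<le> weight p U" by simp
      qed
      moreover have "?w * miss I C (small W) b \<le> ?w"
        using miss_le_1[OF fin] weight_nonneg[of p] p by (intro mult_left_le) auto
      ultimately show ?thesis by (simp add: left_diff_distrib)
    qed
    (* a second-round outcome that contains a small fragment completes some target of H *)
    have "miss I C H (a + b) \<le> ?E (\<lambda>W.
        measure_pmf.expectation (sparse_map I C b) (\<lambda>V. of_bool (\<not> (\<exists>S\<in>H. in_union S W V))))"
      using a b ab less.prems(2) by (intro miss_merge_rounds fin) auto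
    also have "\<dots> \<le> ?E (\<lambda>W. miss I C (small W) b)"
    proof (intro expectation_mono_finite finp)
      fix W
      have "of_bool (\<not> (\<exists>S\<in>H. in_union S W V)) \<le> (of_bool (\<not> (\<exists>T\<in>small W. T \<subseteq>\<^sub>m V)) :: real)" for V
        using fragment_completes[of _ H W V] by (auto simp: small_def)
      then show "measure_pmf.expectation (sparse_map I C b) (\<lambda>V. of_bool (\<not> (\<exists>S\<in>H. in_union S W V)))
          \<le> miss I C (small W) b"
        unfolding miss_def by (intro expectation_mono_finite finite_sparse_map fin)
    qed
    finally have "c * miss I C H (a + b) \<le> c * ?E (\<lambda>W. miss I C (small W) b)"
      using cpos by simp
    also have "\<dots> = ?E (\<lambda>W. c * miss I C (small W) b)"
      by simp
    also have "\<dots> \<le> ?E (\<lambda>W. weight p (large_fragments H ?k W) + (1 - 1 / 2 ^ ?k) / sqrt (1 + x))"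
      by (intro expectation_mono_finite finp second)
    also have "\<dots> = ?E (\<lambda>W. weight p (large_fragments H ?k W)) + (1 - 1 / 2 ^ ?k) / sqrt (1 + x)"
      using finp by (subst Bochner_Integration.integral_add) (auto intro: integrable_measure_pmf_finite)
    also have "?E (\<lambda>W. weight p (large_fragments H ?k W)) \<le> 2 ^ l / L ^ (?k + 1)"
      using a b ab less.prems(2,3) p L by (intro expected_weight_large_fragments fin) (auto simp: a_def)
    also have "\<dots> \<le> 1 / (2 ^ l * sqrt (1 + x))"
      unfolding L_def by (rule round_cost[OF x l])
    also have "1 / (2 ^ l * sqrt (1 + x)) + (1 - 1 / 2 ^ ?k) / sqrt (1 + x)
        = (1 + (1 / 2 ^ l - 1 / 2 ^ ?k)) / sqrt (1 + x)"
      by (simp add: add_divide_distrib diff_divide_distrib)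
    also have "\<dots> \<le> (1 - 1 / 2 ^ l) / sqrt (1 + x)"
    proof (intro divide_right_mono)
      (* the error 1 / 2 ^ l of this round fits between the bounds for l div 2 and for l *)
      have "(2::real) ^ (?k + 1) \<le> 2 ^ l" using l by (intro power_increasing) auto
      then have "2 * (1 / 2 ^ l) \<le> 1 / (2::real) ^ ?k" by (simp add: field_simps)
      then show "1 + (1 / 2 ^ l - 1 / 2 ^ ?k) \<le> (1 - 1 / 2 ^ l :: real)" by simp
    qed (use x in simp)
    finally show ?thesis unfolding rate_eq by simp
  qed
qed


section \<open>From independent positions to a fixed number of positions\<close>

definition random_subset :: "'a set \<Rightarrow> real \<Rightarrow> 'a set pmf" where
  "random_subset I q = map_pmf (\<lambda>f. {x \<in> I. f x}) (Pi_pmf I False (\<lambda>_. bernoulli_pmf q))"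

definition levels :: "'a set \<Rightarrow> nat \<Rightarrow> 'a set set" where
  "levels I k = {S. S \<subseteq> I \<and> card S = k}"

lemma finite_levels: "finite I \<Longrightarrow> finite (levels I k)"
  by (rule finite_subset[of _ "Pow I"]) (auto simp: levels_def)

lemma card_levels: "finite I \<Longrightarrow> card (levels I k) = card I choose k"
  unfolding levels_def by (rule n_subsets)

lemma finite_random_subset: "finite I \<Longrightarrow> finite (set_pmf (random_subset I q))"
  unfolding random_subset_def set_map_pmf by (intro finite_imageI finite_set_Pi_pmf) auto

lemma expectation_random_subset:
  fixes G :: "'a set \<Rightarrow> real"
  assumes "finite I" "0 \<le> q" "q \<le> 1"
  shows "measure_pmf.expectation (random_subset I q) G =
           (\<Sum>S\<in>Pow I. q ^ card S * (1 - q) ^ (card I - card S) * G S)"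
proof -
  let ?P = "Pi_pmf I False (\<lambda>_. bernoulli_pmf q)"
  have "measure_pmf.expectation (random_subset I q) G =
      (\<Sum>f\<in>PiE_dflt I False (\<lambda>_. UNIV). pmf ?P f * G {x \<in> I. f x})"
  proof -
    have "finite (PiE_dflt I False (\<lambda>_. UNIV :: bool set))"
      using assms by (intro finite_PiE_dflt) auto
    moreover have "f \<in> PiE_dflt I False (\<lambda>_. UNIV)" if "f \<in> set_pmf ?P" for f
      using that set_Pi_pmf_subset[OF assms(1)] by (fastforce simp: PiE_dflt_def)
    ultimately show ?thesis
      unfolding random_subset_def integral_map_pmf
      by (subst integral_measure_pmf_real[where A = "PiE_dflt I False (\<lambda>_. UNIV)"])
         (auto simp: mult.commute)
  qed
  also have "\<dots> = (\<Sum>S\<in>Pow I. pmf ?P (\<lambda>x. x \<in> S) * G S)"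
    by (rule sum.reindex_bij_witness[of _ "\<lambda>S x. x \<in> S" "\<lambda>f. {x \<in> I. f x}"])
       (auto simp: PiE_dflt_def fun_eq_iff intro!: arg_cong2[of _ _ _ _ "(*)"] arg_cong[of _ _ "pmf ?P"])
  also have "\<dots> = (\<Sum>S\<in>Pow I. q ^ card S * (1 - q) ^ (card I - card S) * G S)"
  proof (intro sum.cong refl arg_cong2[of _ _ _ _ "(*)"])
    fix S assume "S \<in> Pow I"
    then have S: "S \<subseteq> I" "finite S" using assms(1) by (auto intro: finite_subset)
    have "pmf ?P (\<lambda>x. x \<in> S) = (\<Prod>x\<in>I. pmf (bernoulli_pmf q) (x \<in> S))"
      using S assms by (intro pmf_Pi') auto
    also have "\<dots> = (\<Prod>x\<in>I. if x \<in> S then q else 1 - q)"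
      using assms by (intro prod.cong refl) auto
    also have "\<dots> = q ^ card S * (1 - q) ^ (card I - card S)"
      using S assms by (simp add: prod.If_cases Int_absorb1 Diff_eq[symmetric] card_Diff_subset)
    finally show "pmf ?P (\<lambda>x. x \<in> S) = q ^ card S * (1 - q) ^ (card I - card S)" .
  qed
  finally show ?thesis .
qed

text \<open>
  Double counting of the pairs \<open>(S', x)\<close> with \<open>x \<in> S'\<close>, which correspond to the pairs \<open>(S, x)\<close>
  with \<open>x \<notin> S\<close> through \<open>S = S' - {x}\<close>.
\<close>

lemma average_levels_Suc:
  fixes G :: "'a set \<Rightarrow> real"
  assumes fin: "finite I" and anti: "\<And>S S'. S \<subseteq> S' \<Longrightarrow> S' \<subseteq> I \<Longrightarrow> G S' \<le> G S"
    and k: "k < card I"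
  shows "sum G (levels I (Suc k)) / (card I choose Suc k) \<le> sum G (levels I k) / (card I choose k)"
proof -
  have finS: "finite S" if "S \<in> levels I j" for S j
    using that fin by (auto simp: levels_def intro: finite_subset)
  have "real (Suc k) * sum G (levels I (Suc k)) = (\<Sum>S'\<in>levels I (Suc k). \<Sum>x\<in>S'. G S')"
    by (simp add: levels_def sum_distrib_left)
  also have "\<dots> \<le> (\<Sum>S'\<in>levels I (Suc k). \<Sum>x\<in>S'. G (S' - {x}))"
    by (intro sum_mono anti) (auto simp: levels_def)
  also have "\<dots> = (\<Sum>(S', x)\<in>Sigma (levels I (Suc k)) (\<lambda>S'. S'). G (S' - {x}))"
    using finite_levels[OF fin] finS by (intro sum.Sigma) auto
  also have "\<dots> = (\<Sum>(S, x)\<in>Sigma (levels I k) (\<lambda>S. I - S). G S)"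
    by (rule sum.reindex_bij_witness[of _ "\<lambda>(S, x). (insert x S, x)" "\<lambda>(S', x). (S' - {x}, x)"])
       (use fin in \<open>auto simp: levels_def insert_absorb dest: finite_subset\<close>)
  also have "\<dots> = (\<Sum>S\<in>levels I k. \<Sum>x\<in>I - S. G S)"
    using finite_levels[OF fin] fin by (intro sum.Sigma[symmetric]) auto
  also have "\<dots> = (card I - k) * sum G (levels I k)"
  proof -
    have "card (I - S) = card I - k" if "S \<in> levels I k" for S
      using that finS[OF that] by (auto simp: levels_def card_Diff_subset)
    then show ?thesis by (simp add: sum_distrib_left)
  qed
  finally have main: "real (Suc k) * sum G (levels I (Suc k)) \<le> real (card I - k) * sum G (levels I k)" .
  have "Suc k * (card I choose Suc k) = (card I - k) * (card I choose k)"
    using k by (metis Suc_times_binomial_eq binomial_absorb_comp binomial_absorption mult.commute)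
  then have ch: "real (Suc k) * real (card I choose Suc k) = real (card I - k) * real (card I choose k)"
    by (metis of_nat_mult)
  have pos: "0 < real (card I choose Suc k)" "0 < real (card I choose k)" "0 < real (Suc k)" "0 < real (card I - k)"
    using k by simp_all
  have "real (Suc k) * (sum G (levels I (Suc k)) * (card I choose k))
      \<le> real (Suc k) * (sum G (levels I k) * (card I choose Suc k))"
  proof -
    have "real (Suc k) * (sum G (levels I (Suc k)) * (card I choose k))
        \<le> real (card I - k) * sum G (levels I k) * (card I choose k)"
      using mult_right_mono[OF main, of "card I choose k"] by (simp only: mult.assoc of_nat_0_le_iff)
    also have "\<dots> = sum G (levels I k) * (real (card I - k) * real (card I choose k))"
      by (simp only: mult_ac)
    also have "\<dots> = real (Suc k) * (sum G (levels I k) * (card I choose Suc k))"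
      unfolding ch[symmetric] by (simp only: mult_ac)
    finally show ?thesis .
  qed
  then have "sum G (levels I (Suc k)) * (card I choose k) \<le> sum G (levels I k) * (card I choose Suc k)"
    using pos(3) by (rule mult_left_le_imp_le)
  then show ?thesis using pos by (simp add: divide_simps)
qed

lemma average_levels_antimono:
  fixes G :: "'a set \<Rightarrow> real"
  assumes fin: "finite I" and anti: "\<And>S S'. S \<subseteq> S' \<Longrightarrow> S' \<subseteq> I \<Longrightarrow> G S' \<le> G S"
    and "k \<le> m" "m \<le> card I"
  shows "sum G (levels I m) / (card I choose m) \<le> sum G (levels I k) / (card I choose k)"
  using assms(3,4)
proof (induction m rule: dec_induct)
  case base
  then show ?case by simp
next
  case (step j)
  then show ?case using average_levels_Suc[of I G j] fin anti by simp
qed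

text \<open>
  Markov's inequality for the size, whose mean is \<open>card I * q \<le> m / 2\<close>.
\<close>

lemma random_subset_small:
  fixes q :: real
  assumes "finite I" "0 \<le> q" "q \<le> 1" "2 * card I * q \<le> m"
  shows "measure_pmf.expectation (random_subset I q) (\<lambda>S. of_bool (card S \<le> m)) \<ge> (1/2 :: real)"
proof -
  let ?E = "measure_pmf.expectation (random_subset I q) :: ('a set \<Rightarrow> real) \<Rightarrow> real"
  note fin = finite_random_subset[OF assms(1), of q]
  have "?E (\<lambda>S. real (card S)) =
      measure_pmf.expectation (Pi_pmf I False (\<lambda>_. bernoulli_pmf q)) (\<lambda>f. \<Sum>x\<in>I. of_bool (f x))"
    using assms(1) by (simp add: random_subset_def Int_def)
  also have "\<dots> = (\<Sum>x\<in>I. measure_pmf.expectation (map_pmf (\<lambda>f. f x)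
      (Pi_pmf I False (\<lambda>_. bernoulli_pmf q))) of_bool)"
    using assms(1)
    by (subst Bochner_Integration.integral_sum)
       (auto intro!: integrable_measure_pmf_finite finite_set_Pi_pmf)
  also have "\<dots> = (\<Sum>x\<in>I. measure_pmf.expectation (bernoulli_pmf q) of_bool)"
    using assms(1) by (intro sum.cong refl) (simp add: Pi_pmf_component del: integral_map_pmf)
  also have "\<dots> = card I * q" using assms by simp
  finally have mean: "?E (\<lambda>S. real (card S)) = card I * q" .
  have "1 - ?E (\<lambda>S. of_bool (card S \<le> m)) = ?E (\<lambda>S. 1 - of_bool (card S \<le> m))"
    using fin
    by (subst Bochner_Integration.integral_diff) (auto intro: integrable_measure_pmf_finite)
  then have "(real m + 1) * (1 - ?E (\<lambda>S. of_bool (card S \<le> m)))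
      = ?E (\<lambda>S. (real m + 1) * (1 - of_bool (card S \<le> m)))"
    by (simp only: integral_mult_right_zero)
  also have "\<dots> \<le> ?E (\<lambda>S. real (card S))"
    by (intro expectation_mono_finite fin) auto
  also have "\<dots> \<le> (real m + 1) * (1 / 2)" using mean assms(4) by simp
  finally have "1 - ?E (\<lambda>S. of_bool (card S \<le> m)) \<le> 1 / 2"
    by (rule mult_left_le_imp_le) simp
  then show ?thesis by simp
qed

text \<open>
  Conditioned on its size, a random subset is uniform. On the event that its size is at most \<open>m\<close>,
  of probability at least one half, the conditional mean of \<open>G\<close> is at least the mean over sets of
  size \<open>m\<close>, as \<open>G\<close> is decreasing.
\<close>

lemma fixed_size_le_random_subset:
  fixes G :: "'a set \<Rightarrow> real" and q :: real
  assumes fin: "finite I" and q: "0 \<le> q" "q \<le> 1" "2 * card I * q \<le> m" and m: "m \<le> card I"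
    and anti: "\<And>S S'. S \<subseteq> S' \<Longrightarrow> S' \<subseteq> I \<Longrightarrow> G S' \<le> G S" and nonneg: "\<And>S. 0 \<le> G S"
  shows "measure_pmf.expectation (pmf_of_set (levels I m)) G
           \<le> 2 * measure_pmf.expectation (random_subset I q) G"
proof -
  define avg where "avg k = sum G (levels I k) / (card I choose k)" for k
  define w where "w k = q ^ k * (1 - q) ^ (card I - k)" for k
  have w: "0 \<le> w k" for k using q by (simp add: w_def)
  have "levels I m \<noteq> {}"
    using card_levels[OF fin, of m] m by (metis binomial_eq_0_iff card.empty linorder_not_le)
  then have fixed: "measure_pmf.expectation (pmf_of_set (levels I m)) G = avg m"
    using finite_levels[OF fin] by (simp add: integral_pmf_of_set card_levels[OF fin] avg_def)
  have avg_nonneg: "0 \<le> avg m" unfolding avg_def by (intro divide_nonneg_nonneg sum_nonneg nonneg) simp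
  have split: "measure_pmf.expectation (random_subset I q) (\<lambda>S. of_bool (card S \<le> m) * F S)
      = (\<Sum>k\<le>m. w k * sum F (levels I k))" for F :: "'a set \<Rightarrow> real"
  proof -
    have "measure_pmf.expectation (random_subset I q) (\<lambda>S. of_bool (card S \<le> m) * F S)
        = (\<Sum>S\<in>Pow I. if card S \<le> m then w (card S) * F S else 0)"
      unfolding expectation_random_subset[OF fin q(1,2)] w_def by (intro sum.cong) auto
    also have "\<dots> = (\<Sum>S\<in>(\<Union>k\<le>m. levels I k). w (card S) * F S)"
      using fin by (intro sum.mono_neutral_cong_right) (auto simp: levels_def)
    also have "\<dots> = (\<Sum>k\<le>m. \<Sum>S\<in>levels I k. w (card S) * F S)"
      by (intro sum.UNION_disjoint) (auto simp: finite_levels[OF fin], auto simp: levels_def)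
    also have "\<dots> = (\<Sum>k\<le>m. w k * sum F (levels I k))"
      by (intro sum.cong) (auto simp: levels_def sum_distrib_left)
    finally show ?thesis .
  qed
  have "1 / 2 * avg m \<le> measure_pmf.expectation (random_subset I q) (\<lambda>S. of_bool (card S \<le> m)) * avg m"
    using random_subset_small[OF fin q] avg_nonneg by (intro mult_right_mono)
  also have "\<dots> = (\<Sum>k\<le>m. w k * real (card I choose k)) * avg m"
    using split[of "\<lambda>_. 1"] by (simp add: card_levels[OF fin])
  also have "\<dots> = (\<Sum>k\<le>m. w k * ((card I choose k) * avg m))"
    by (simp add: sum_distrib_right mult.assoc)
  also have "\<dots> \<le> (\<Sum>k\<le>m. w k * ((card I choose k) * avg k))"
    unfolding avg_def using m
    by (intro sum_mono mult_left_mono average_levels_antimono fin anti w) auto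
  also have "\<dots> = (\<Sum>k\<le>m. w k * sum G (levels I k))"
    unfolding avg_def using m by (intro sum.cong refl) (simp add: binomial_eq_0_iff)
  also have "\<dots> = measure_pmf.expectation (random_subset I q) (\<lambda>S. of_bool (card S \<le> m) * G S)"
    by (simp add: split)
  also have "\<dots> \<le> measure_pmf.expectation (random_subset I q) G"
    using nonneg by (intro expectation_mono_finite finite_random_subset fin) auto
  finally show ?thesis unfolding fixed by simp
qed

definition random_fill :: "'b set \<Rightarrow> 'a set \<Rightarrow> ('a \<rightharpoonup> 'b) pmf" where
  "random_fill C S = Pi_pmf S None (\<lambda>_. map_pmf Some (pmf_of_set C))"

lemma finite_random_fill:
  assumes "finite S" "finite C" "C \<noteq> {}"
  shows "finite (set_pmf (random_fill C S))"
  unfolding random_fill_def using assms by (intro finite_set_Pi_pmf) auto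

lemma sparse_map_eq_bind_fill:
  assumes "finite I"
  shows "sparse_map I C q = bind_pmf (random_subset I q) (random_fill C)"
proof -
  have "sparse_map I C q = bind_pmf (Pi_pmf I False (\<lambda>_. bernoulli_pmf q))
      (\<lambda>f. Pi_pmf I None (\<lambda>x. if f x then map_pmf Some (pmf_of_set C) else return_pmf None))"
    unfolding sparse_map_def sparse_entry_def by (rule Pi_pmf_bind[OF assms])
  then show ?thesis
    by (simp add: Pi_pmf_if_set[OF assms] random_subset_def bind_map_pmf random_fill_def)
qed

text \<open>
  Filling \<open>S\<close> amounts to filling \<open>S'\<close> and erasing the entries outside \<open>S\<close>.
\<close>

lemma random_fill_miss_antimono:
  assumes "finite S'" "S \<subseteq> S'" "finite C" "C \<noteq> {}"
  shows "measure_pmf.expectation (random_fill C S') (\<lambda>W. of_bool (\<not> (\<exists>R\<in>H. R \<subseteq>\<^sub>m W)))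
     \<le> measure_pmf.expectation (random_fill C S) (\<lambda>W. of_bool (\<not> (\<exists>R\<in>H. R \<subseteq>\<^sub>m W)) :: real)"
proof -
  have "random_fill C S = map_pmf (\<lambda>W x. if x \<in> S then W x else None) (random_fill C S')"
    unfolding random_fill_def by (rule Pi_pmf_subset[OF assms(1,2)])
  moreover have "(\<lambda>x. if x \<in> S then W x else None) \<subseteq>\<^sub>m W" for W :: "'a \<rightharpoonup> 'b"
    by (auto simp: map_le_def split: if_splits)
  then have "of_bool (\<not> (\<exists>R\<in>H. R \<subseteq>\<^sub>m W))
      \<le> (of_bool (\<not> (\<exists>R\<in>H. R \<subseteq>\<^sub>m (\<lambda>x. if x \<in> S then W x else None))) :: real)" for W
    using map_le_trans by fastforce
  ultimately show ?thesis
    by (simp add: expectation_mono_finite finite_random_fill assms)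
qed

lemma miss_fixed_size:
  fixes q :: real
  assumes fin: "finite I" "finite C" "C \<noteq> {}"
    and q: "0 \<le> q" "q \<le> 1" "2 * card I * q \<le> m" and m: "m \<le> card I"
  shows "measure_pmf.expectation (bind_pmf (pmf_of_set (levels I m)) (random_fill C))
           (\<lambda>W. of_bool (\<not> (\<exists>S\<in>H. S \<subseteq>\<^sub>m W))) \<le> 2 * miss I C H q"
proof -
  define G :: "'a set \<Rightarrow> real" where
    "G = (\<lambda>D. measure_pmf.expectation (random_fill C D) (\<lambda>W. of_bool (\<not> (\<exists>S\<in>H. S \<subseteq>\<^sub>m W))))"
  have ne: "levels I m \<noteq> {}"
    using card_levels[OF fin(1), of m] m by (metis binomial_eq_0_iff card.empty linorder_not_le)
  have finD: "finite D" if "D \<in> levels I m" for D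
    using that fin(1) by (auto simp: levels_def intro: finite_subset)
  have "measure_pmf.expectation (bind_pmf (pmf_of_set (levels I m)) (random_fill C))
           (\<lambda>W. of_bool (\<not> (\<exists>S\<in>H. S \<subseteq>\<^sub>m W))) = measure_pmf.expectation (pmf_of_set (levels I m)) G"
    unfolding G_def using ne finD finite_levels[OF fin(1)] fin
    by (intro expectation_bind_finite finite_random_fill) auto
  also have "\<dots> \<le> 2 * measure_pmf.expectation (random_subset I q) G"
    unfolding G_def using fin q m finite_subset
    by (intro fixed_size_le_random_subset random_fill_miss_antimono Bochner_Integration.integral_nonneg) auto
  also have "measure_pmf.expectation (random_subset I q) G = miss I C H q"
    unfolding G_def miss_def sparse_map_eq_bind_fill[OF fin(1)] using fin
    by (intro expectation_bind_finite[symmetric] finite_random_fill finite_random_subset)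
       (auto simp: random_subset_def)
  finally show ?thesis .
qed


section \<open>Covers of the latin transversals\<close>

definition transversal :: "nat \<Rightarrow> (nat \<Rightarrow> nat) \<Rightarrow> (nat \<Rightarrow> nat) \<Rightarrow> (nat \<times> nat \<rightharpoonup> nat)" where
  "transversal n \<sigma> \<tau> = (\<lambda>(i, j). if i \<in> {1..n} \<and> j = \<sigma> i then Some (\<tau> i) else None)"

definition transversals :: "nat \<Rightarrow> (nat \<times> nat \<rightharpoonup> nat) set" where
  "transversals n =
     (\<lambda>(\<sigma>, \<tau>). transversal n \<sigma> \<tau>) ` ({\<sigma>. \<sigma> permutes {1..n}} \<times> {\<tau>. \<tau> permutes {1..n}})"

lemma dom_transversal: "dom (transversal n \<sigma> \<tau>) = (\<lambda>i. (i, \<sigma> i)) ` {1..n}"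
  by (auto simp: transversal_def dom_def split: if_splits)

lemma transversals_partial_maps: "transversals n \<subseteq> partial_maps (positions n) {1..n}"
proof
  fix S assume "S \<in> transversals n"
  then obtain \<sigma> \<tau> where S: "S = transversal n \<sigma> \<tau>" and perm: "\<sigma> permutes {1..n}" "\<tau> permutes {1..n}"
    by (auto simp: transversals_def)
  have "dom S \<subseteq> positions n"
    unfolding S dom_transversal positions_def using permutes_in_image[OF perm(1)] by blast
  moreover have "ran S \<subseteq> {1..n}"
  proof
    fix c assume "c \<in> ran S"
    then obtain i where "i \<in> {1..n}" "c = \<tau> i"
      by (auto simp: S transversal_def ran_def split: if_splits)
    then show "c \<in> {1..n}" using permutes_in_image[OF perm(2)] by blast
  qed
  ultimately show "S \<in> partial_maps (positions n) {1..n}" by (simp add: partial_maps_def)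
qed

lemma card_dom_transversals: "S \<in> transversals n \<Longrightarrow> card (dom S) = n"
  by (auto simp: transversals_def dom_transversal card_image inj_on_def)

lemma contains_latin_transversalI:
  assumes "S \<in> transversals n" "S \<subseteq>\<^sub>m W"
  shows "contains_latin_transversal n (\<lambda>x. case W x of None \<Rightarrow> 0 | Some c \<Rightarrow> c)"
proof -
  from assms(1) obtain \<sigma> \<tau>
    where S: "S = transversal n \<sigma> \<tau>" and \<sigma>: "\<sigma> permutes {1..n}" and \<tau>: "\<tau> permutes {1..n}"
    by (auto simp: transversals_def)
  define B :: "nat \<times> nat \<Rightarrow> nat" where "B = (\<lambda>(i, j). if j = \<sigma> i then \<tau> i else 0)"
  have \<tau>_in: "\<tau> i \<in> {1..n}" if "i \<in> {1..n}" for i using permutes_in_image[OF \<tau>] that by blast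
  have \<sigma>_in: "\<sigma> i \<in> {1..n}" if "i \<in> {1..n}" for i using permutes_in_image[OF \<sigma>] that by blast
  have B: "B (i, j) \<noteq> 0 \<longleftrightarrow> j = \<sigma> i" if "i \<in> {1..n}" for i j
    using \<tau>_in[OF that] by (auto simp: B_def)
  have W: "W (i, \<sigma> i) = Some (\<tau> i)" if "i \<in> {1..n}" for i
    using assms(2) that unfolding S map_le_def dom_transversal
    by (auto simp: transversal_def)
  have "is_latin_transversal_of n (\<lambda>x. case W x of None \<Rightarrow> 0 | Some c \<Rightarrow> c) B"
    unfolding is_latin_transversal_of_def
  proof (intro conjI ballI impI)
    fix x assume x: "x \<in> positions n" "B x \<noteq> 0"
    then obtain i j where ij: "x = (i, j)" "i \<in> {1..n}" by (auto simp: positions_def)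
    then have "j = \<sigma> i" using x(2) B by blast
    then show "B x = (case W x of None \<Rightarrow> 0 | Some c \<Rightarrow> c)"
      using ij W by (simp add: B_def)
  next
    fix i assume i: "i \<in> {1..n}"
    show "\<exists>!j. j \<in> {1..n} \<and> B (i, j) \<noteq> 0"
      by (rule ex1I[of _ "\<sigma> i"]) (use \<sigma>_in[OF i] B[OF i] in auto)
  next
    fix j assume j: "j \<in> {1..n}"
    then have "j \<in> \<sigma> ` {1..n}" using permutes_image[OF \<sigma>] by simp
    then obtain i where i: "i \<in> {1..n}" "j = \<sigma> i" by blast
    show "\<exists>!i. i \<in> {1..n} \<and> B (i, j) \<noteq> 0"
    proof (rule ex1I[of _ i])
      show "i \<in> {1..n} \<and> B (i, j) \<noteq> 0" using i B by blast
      show "i' = i" if "i' \<in> {1..n} \<and> B (i', j) \<noteq> 0" for i'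
        using that B i permutes_inj[OF \<sigma>] by (auto dest: injD)
    qed
  next
    fix x assume "x \<in> {1..n}"
    then have "x \<in> \<tau> ` {1..n}" using permutes_image[OF \<tau>] by simp
    then obtain i where i: "i \<in> {1..n}" "x = \<tau> i" by blast
    then show "\<exists>p\<in>positions n. B p = x"
      using \<sigma>_in by (intro bexI[of _ "(i, \<sigma> i)"]) (auto simp: B_def positions_def)
  qed
  then show ?thesis unfolding contains_latin_transversal_def by blast
qed

text \<open>
  Composing with the inverse of \<open>\<rho>\<close> yields permutations that fix \<open>R\<close> pointwise.
\<close>

lemma card_permutes_agreeing_le:
  assumes "finite S" "R \<subseteq> S" "\<rho> permutes S"
  shows "card {\<sigma>. \<sigma> permutes S \<and> (\<forall>x\<in>R. \<sigma> x = \<rho> x)} \<le> fact (card S - card R)"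
proof -
  have "card {\<sigma>. \<sigma> permutes S \<and> (\<forall>x\<in>R. \<sigma> x = \<rho> x)} \<le> card {\<pi>. \<pi> permutes (S - R)}"
  proof (rule card_inj_on_le)
    show "inj_on (\<lambda>\<sigma>. inv \<rho> \<circ> \<sigma>) {\<sigma>. \<sigma> permutes S \<and> (\<forall>x\<in>R. \<sigma> x = \<rho> x)}"
      using permutes_bij[OF assms(3)] by (auto simp: inj_on_def fun_eq_iff bij_def surj_f_inv_f inj_eq[OF bij_is_inj[OF bij_imp_bij_inv]])
    show "(\<lambda>\<sigma>. inv \<rho> \<circ> \<sigma>) ` {\<sigma>. \<sigma> permutes S \<and> (\<forall>x\<in>R. \<sigma> x = \<rho> x)} \<subseteq> {\<pi>. \<pi> permutes (S - R)}"
    proof safe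
      fix \<sigma> assume \<sigma>: "\<sigma> permutes S" "\<forall>x\<in>R. \<sigma> x = \<rho> x"
      have "inv \<rho> \<circ> \<sigma> permutes S"
        using \<sigma>(1) assms(3) by (intro permutes_compose permutes_inv)
      then show "inv \<rho> \<circ> \<sigma> permutes S - R"
        by (rule permutes_superset) (use \<sigma>(2) permutes_inverses(2)[OF assms(3)] in auto)
    qed
    show "finite {\<pi>. \<pi> permutes (S - R)}" using assms(1) by (intro finite_permutations) auto
  qed
  also have "\<dots> = fact (card S - card R)"
    using assms(1,2) by (intro card_permutations) (auto simp: card_Diff_subset finite_subset)
  finally show ?thesis .
qed

lemma card_transversals_containing_le:
  fixes T :: "nat \<times> nat \<rightharpoonup> nat" and n :: nat
  defines "A \<equiv> {(\<sigma>, \<tau>). \<sigma> permutes {1..n} \<and> \<tau> permutes {1..n} \<and> T \<subseteq>\<^sub>m transversal n \<sigma> \<tau>}"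
  assumes "A \<noteq> {}"
  shows "card (dom T) \<le> n" "card A \<le> (fact (n - card (dom T)))\<^sup>2"
proof -
  obtain \<sigma>' \<tau>' where st: "\<sigma>' permutes {1..n}" "\<tau>' permutes {1..n}" "T \<subseteq>\<^sub>m transversal n \<sigma>' \<tau>'"
    using assms by auto
  define R where "R = fst ` dom T"
  have entry: "i \<in> {1..n} \<and> j = \<sigma> i \<and> T (i, j) = Some (\<tau> i)"
    if "T \<subseteq>\<^sub>m transversal n \<sigma> \<tau>" "(i, j) \<in> dom T" for \<sigma> \<tau> i j
  proof -
    have "T (i, j) = transversal n \<sigma> \<tau> (i, j)" using that by (simp add: map_le_def)
    then show ?thesis using that(2) by (auto simp: transversal_def split: if_splits)
  qed
  have "snd x = \<sigma>' (fst x)" if "x \<in> dom T" for x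
    using entry[OF st(3), of "fst x" "snd x"] that by simp
  then have "inj_on fst (dom T)"
    by (metis inj_onI prod_eq_iff)
  then have cardR: "card R = card (dom T)" by (simp add: R_def card_image)
  have R: "R \<subseteq> {1..n}" using entry[OF st(3)] by (force simp: R_def)
  show "card (dom T) \<le> n" using card_mono[OF _ R] cardR by simp
  let ?X = "\<lambda>\<rho>. {\<sigma>. \<sigma> permutes {1..n} \<and> (\<forall>x\<in>R. \<sigma> x = \<rho> x)}"
  have "A \<subseteq> ?X \<sigma>' \<times> ?X \<tau>'"
  proof
    fix z assume "z \<in> A"
    then obtain \<sigma> \<tau> where z: "z = (\<sigma>, \<tau>)" "\<sigma> permutes {1..n}" "\<tau> permutes {1..n}" "T \<subseteq>\<^sub>m transversal n \<sigma> \<tau>"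
      by (auto simp: A_def)
    have "\<sigma> i = \<sigma>' i \<and> \<tau> i = \<tau>' i" if iR: "i \<in> R" for i
    proof -
      obtain j where "(i, j) \<in> dom T" using iR unfolding R_def by force
      then show ?thesis using entry[OF st(3), of i j] entry[OF z(4), of i j] by auto
    qed
    then show "z \<in> ?X \<sigma>' \<times> ?X \<tau>'" using z by simp
  qed
  moreover have fin: "finite (?X \<rho>)" for \<rho>
    by (rule finite_subset[OF _ finite_permutations[of "{1..n}"]]) auto
  ultimately have "card A \<le> card (?X \<sigma>') * card (?X \<tau>')"
    using card_mono[of "?X \<sigma>' \<times> ?X \<tau>'" A] by (simp add: card_cartesian_product)
  also have "\<dots> \<le> fact (n - card (dom T)) * fact (n - card (dom T))"
    using card_permutes_agreeing_le[OF _ R st(1)] card_permutes_agreeing_le[OF _ R st(2)] cardR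
    by (intro mult_le_mono) simp_all
  finally show "card A \<le> (fact (n - card (dom T)))\<^sup>2" by (simp add: power2_eq_square)
qed

lemma power_self_le_exp_fact: "real t ^ t \<le> exp (real t) * fact t"
proof -
  have "real t ^ t / fact t \<le> (\<Sum>k. real t ^ k / fact k)"
    using sum_le_suminf[of "\<lambda>k. real t ^ k / fact k" "{t}"] summable_exp[of "real t"]
    by (simp add: divide_inverse mult.commute)
  also have "\<dots> = exp (real t)" by (simp add: exp_def divide_inverse mult.commute scaleR_conv_of_real)
  finally show ?thesis by (simp add: divide_simps)
qed

text \<open>
  The falling factorial \<open>n! / (n - t)! = (n choose t) * t!\<close> is at least
  \<open>(n / t) ^ t * (t / e) ^ t\<close>.
\<close>

lemma fact_diff_le:
  assumes "t \<le> n" "0 < n"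
  shows "(fact (n - t) :: real) \<le> (exp 1 / n) ^ t * fact n"
proof -
  have "(real n / t) ^ t \<le> real (n choose t)" using assms by (intro binomial_ge_n_over_k_pow_k)
  moreover have "real t ^ t > 0" by (cases t) auto
  ultimately have "real n ^ t \<le> (n choose t) * real t ^ t"
    by (simp add: power_divide divide_simps)
  also have "\<dots> \<le> (n choose t) * (exp (real t) * fact t)"
    by (intro mult_left_mono power_self_le_exp_fact) simp
  finally have "real n ^ t * fact (n - t) \<le> (n choose t) * (exp (real t) * fact t) * fact (n - t)"
    by (intro mult_right_mono) simp_all
  also have "\<dots> = exp (real t) * (fact t * fact (n - t) * real (n choose t))"
    by (simp only: mult_ac of_nat_mult)
  also have "fact t * fact (n - t) * real (n choose t) = fact n"
    using binomial_fact_lemma[OF assms(1)] by (metis of_nat_fact of_nat_mult)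
  also have "exp (real t) = exp 1 ^ t" by (simp flip: exp_of_nat_mult)
  finally show ?thesis using assms by (simp add: power_divide divide_simps mult.commute)
qed

text \<open>
  Union bound over the cover for a uniformly random pair of permutations.
\<close>

lemma one_le_weight_cover_transversals:
  assumes "0 < n" "U \<subseteq> partial_maps (positions n) {1..n}" "covers U (transversals n)"
  shows "1 \<le> weight ((exp 1 / n)\<^sup>2) U"
proof -
  let ?P = "{\<sigma>. \<sigma> permutes {1..n}}"
  define A where "A T = {(\<sigma>, \<tau>). \<sigma> permutes {1..n} \<and> \<tau> permutes {1..n} \<and> T \<subseteq>\<^sub>m transversal n \<sigma> \<tau>}" for T
  have "finite (partial_maps (positions n) {1..n})"
    by (intro finite_partial_maps) (auto simp: positions_def)
  then have finU: "finite U" using assms(2) finite_subset by blast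
  have finP: "finite ?P" by (intro finite_permutations) simp
  have finA: "finite (A T)" for T
    by (rule finite_subset[of _ "?P \<times> ?P"]) (use finP in \<open>auto simp: A_def\<close>)
  have "card (?P \<times> ?P) = (fact n)\<^sup>2"
    using card_permutations[of "{1..n}" n] by (simp add: card_cartesian_product power2_eq_square)
  moreover have "card (?P \<times> ?P) \<le> card (\<Union>T\<in>U. A T)"
  proof (rule card_mono)
    show "?P \<times> ?P \<subseteq> (\<Union>T\<in>U. A T)"
    proof
      fix z assume z: "z \<in> ?P \<times> ?P"
      then have "transversal n (fst z) (snd z) \<in> transversals n"
        by (force simp: transversals_def)
      then obtain T where "T \<in> U" "T \<subseteq>\<^sub>m transversal n (fst z) (snd z)"
        using assms(3) by (auto simp: covers_def)
      then show "z \<in> (\<Union>T\<in>U. A T)" using z by (auto simp: A_def)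
    qed
  qed (use finU finA in auto)
  moreover have "card (\<Union>T\<in>U. A T) \<le> (\<Sum>T\<in>U. card (A T))" by (rule card_UN_le[OF finU])
  ultimately have "(fact n)\<^sup>2 \<le> (\<Sum>T\<in>U. card (A T))" by linarith
  then have "real ((fact n)\<^sup>2) \<le> real (\<Sum>T\<in>U. card (A T))" by (rule of_nat_mono)
  then have "(fact n)\<^sup>2 \<le> (\<Sum>T\<in>U. real (card (A T)))" by simp
  also have "\<dots> \<le> (\<Sum>T\<in>U. ((exp 1 / n)\<^sup>2) ^ card (dom T) * (fact n)\<^sup>2)"
  proof (rule sum_mono)
    fix T
    show "real (card (A T)) \<le> ((exp 1 / n)\<^sup>2) ^ card (dom T) * (fact n)\<^sup>2"
    proof (cases "A T = {}")
      case False
      note cnt = card_transversals_containing_le[of n T, folded A_def, OF False]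
      have "real (card (A T)) \<le> real ((fact (n - card (dom T)))\<^sup>2)"
        using cnt(2) by (rule of_nat_mono)
      also have "\<dots> = (fact (n - card (dom T)))\<^sup>2" by simp
      also have "\<dots> \<le> ((exp 1 / n) ^ card (dom T) * fact n)\<^sup>2"
        using fact_diff_le[OF cnt(1) assms(1)] by (intro power_mono) simp_all
      also have "\<dots> = ((exp 1 / n)\<^sup>2) ^ card (dom T) * (fact n)\<^sup>2"
        by (simp only: power_mult_distrib power_mult[symmetric] mult.commute)
      finally show ?thesis .
    qed simp
  qed
  also have "\<dots> = weight ((exp 1 / n)\<^sup>2) U * (fact n)\<^sup>2"
    by (simp add: weight_def sum_distrib_right)
  finally show ?thesis by simp
qed


section \<open>Latin transversals in random matrices\<close>

lemma finite_positions: "finite (positions n)"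
  by (simp add: positions_def)

lemma card_positions: "card (positions n) = n\<^sup>2"
  by (simp add: positions_def card_cartesian_product power2_eq_square)

lemma random_matrix_eq:
  assumes "0 < n" "m \<le> n\<^sup>2"
  shows "random_matrix n m = map_pmf (\<lambda>W x. case W x of None \<Rightarrow> 0 | Some c \<Rightarrow> c)
           (bind_pmf (pmf_of_set (levels (positions n) m)) (random_fill {1..n}))"
proof -
  note fin = finite_positions[of n]
  have "card (levels (positions n) m) > 0"
    using assms(2) by (simp add: card_levels[OF fin] card_positions)
  then have set: "set_pmf (pmf_of_set (levels (positions n) m)) = levels (positions n) m"
    by (intro set_pmf_of_set) (auto simp: card_gt_0_iff)
  have fill: "Pi_pmf S 0 (\<lambda>_. pmf_of_set {1..n}) =
      map_pmf (\<lambda>W x. case W x of None \<Rightarrow> 0 | Some c \<Rightarrow> c) (random_fill {1..n} S)"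
    if "S \<in> levels (positions n) m" for S
  proof -
    have "finite S" using that fin by (auto simp: levels_def intro: finite_subset)
    then have "Pi_pmf S 0 (\<lambda>_. map_pmf (case_option 0 id) (map_pmf Some (pmf_of_set {1..n})))
        = map_pmf (\<lambda>W. case_option 0 id \<circ> W) (random_fill {1..n} S)"
      unfolding random_fill_def by (rule Pi_pmf_map) simp
    then show ?thesis by (simp add: pmf.map_comp o_def id_def)
  qed
  show ?thesis
    unfolding random_matrix_def levels_def[symmetric] map_bind_pmf
    by (intro bind_pmf_cong refl) (simp only: set fill)
qed

lemma prob_latin_transversal_ge:
  fixes q :: real
  assumes "0 < n" "m \<le> n\<^sup>2" "0 \<le> q" "q \<le> 1" "2 * n\<^sup>2 * q \<le> m"
  shows "1 - 2 * miss (positions n) {1..n} (transversals n) q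
           \<le> measure_pmf.prob (random_matrix n m) {A. contains_latin_transversal n A}"
proof -
  let ?P = "bind_pmf (pmf_of_set (levels (positions n) m)) (random_fill {1..n})"
  let ?hit = "{W. \<exists>S\<in>transversals n. S \<subseteq>\<^sub>m W}"
  have "measure_pmf.prob ?P (- ?hit) = measure_pmf.expectation ?P (indicat_real (- ?hit))"
    by simp
  also have "indicat_real (- ?hit) = (\<lambda>W. of_bool (\<not> (\<exists>S\<in>transversals n. S \<subseteq>\<^sub>m W)))"
    by (auto simp: indicator_def fun_eq_iff)
  also have "measure_pmf.expectation ?P \<dots> \<le> 2 * miss (positions n) {1..n} (transversals n) q"
    using assms by (intro miss_fixed_size finite_positions) (auto simp: card_positions)
  finally have "1 - 2 * miss (positions n) {1..n} (transversals n) q \<le> measure_pmf.prob ?P ?hit"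
    using measure_pmf.prob_compl[of ?hit ?P] by (simp add: Compl_eq_Diff_UNIV)
  also have "\<dots> \<le> measure_pmf.prob ?P
      {W. contains_latin_transversal n (\<lambda>x. case W x of None \<Rightarrow> 0 | Some c \<Rightarrow> c)}"
    by (intro measure_pmf.finite_measure_mono) (auto intro: contains_latin_transversalI)
  also have "\<dots> = measure_pmf.prob (random_matrix n m) {A. contains_latin_transversal n A}"
    unfolding random_matrix_eq[OF assms(1,2)] by (simp add: vimage_def)
  finally show ?thesis .
qed

text \<open>
  The iteration with \<open>x = ln n\<close> and weight \<open>p = (e / n)\<^sup>2\<close>. The constant arises from \<open>e\<^sup>2 \<le> 9\<close>, so
  that \<open>p * n \<le> 9 / n\<close>, and from a total rate of at most \<open>80 * ln n\<close>.
\<close>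

lemma miss_transversals_le:
  assumes n: "3 \<le> n" and large: "720 * ln n / n \<le> 1"
  obtains q :: real where "0 \<le> q" "q \<le> 720 * ln n / n" "q \<le> 1"
    "miss (positions n) {1..n} (transversals n) q \<le> 1 / sqrt (1 + ln n)"
proof -
  define p where "p = (exp 1 / real n)\<^sup>2"
  define q where "q = p * card {1..n} * total_rate (ln n) n"
  have "exp 1 \<le> real n" using exp_le n by linarith
  then have ln1: "1 \<le> ln n" using n by (subst ln_ge_iff) auto
  have p: "0 < p" using n by (simp add: p_def)
  have "1 / 2 \<le> ln (2::real)" using ln2_ge_two_thirds by simp
  then have "log 2 n \<le> ln n / (1 / 2)"
    unfolding log_def using ln1 by (intro divide_left_mono) auto
  then have log2: "log 2 n \<le> 2 * ln n" by simp
  have "total_rate (ln n) n \<le> 16 * (1 + log 2 n) + 32 * ln n"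
    using n ln1 by (intro order_trans[OF total_rate_le]) auto
  also have "\<dots> \<le> 16 * (1 + 2 * ln n) + 32 * ln n"
    using log2 by (intro add_right_mono mult_left_mono add_left_mono) auto
  also have "\<dots> \<le> 80 * ln n"
    using ln1 by simp
  finally have rate: "total_rate (ln n) n \<le> 80 * ln n" .
  have "(exp 1)\<^sup>2 \<le> (3::real)\<^sup>2" using exp_le by (intro power_mono) auto
  then have pn: "p * n \<le> 9 / n"
    using n by (simp add: p_def power2_eq_square field_simps)
  have "q = (p * n) * total_rate (ln n) n" by (simp add: q_def)
  also have "\<dots> \<le> 9 / n * (80 * ln n)"
    using pn rate ln1 total_rate_nonneg[of "ln n" n] by (intro mult_mono) auto
  finally have q: "q \<le> 720 * ln n / n" by simp
  have q0: "0 \<le> q" using p ln1 total_rate_nonneg[of "ln n" n] by (simp add: q_def)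
  have "1 * miss (positions n) {1..n} (transversals n) q \<le> (1 - 1 / 2 ^ n) / sqrt (1 + ln n)"
    unfolding q_def
  proof (rule miss_le_of_covers_heavy)
    show "p * card {1..n} * total_rate (ln n) n \<le> 1" using q large unfolding q_def by linarith
    show "1 \<le> weight p U"
      if "U \<subseteq> partial_maps (positions n) {1..n}" "covers U (transversals n)" for U
      unfolding p_def using n by (intro one_le_weight_cover_transversals that) simp
    show "transversals n \<subseteq> partial_maps (positions n) {1..n}" by (rule transversals_partial_maps)
  qed (use n p ln1 finite_positions in \<open>auto simp: card_dom_transversals\<close>)
  also have "\<dots> \<le> 1 / sqrt (1 + ln n)"
    using ln1 by (intro divide_right_mono) auto
  finally have "miss (positions n) {1..n} (transversals n) q \<le> 1 / sqrt (1 + ln n)" by simp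
  then show thesis using that[of q] q0 q large by linarith
qed

theorem corollary1p3:
  "\<exists>K\<^sub>0::real. \<forall>K\<ge>K\<^sub>0.
     (\<lambda>n. measure_pmf.prob (random_matrix n (nat \<lceil>K * real n * ln (real n)\<rceil>))
            {A. contains_latin_transversal n A}) \<longlonglongrightarrow> 1"
  \<comment> \<open>density \<open>720 * ln n / n\<close> fills \<open>720 * n * ln n\<close> positions on average, at most \<open>m n / 2\<close>\<close>
proof (intro exI[of _ 1440] allI impI)
  fix K :: real assume K: "1440 \<le> K"
  define m where "m n = nat \<lceil>K * real n * ln (real n)\<rceil>" for n :: nat
  let ?prob = "\<lambda>n. measure_pmf.prob (random_matrix n (m n)) {A. contains_latin_transversal n A}"
  have "(\<lambda>n. K * (ln (real n) / real n)) \<longlonglongrightarrow> K * 0"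
    by (intro tendsto_intros)
  then have small: "\<forall>\<^sub>F n in sequentially. K * (ln (real n) / real n) < 1"
    by (rule order_tendstoD) simp
  have lower: "\<forall>\<^sub>F n in sequentially. 1 - 2 * (1 / sqrt (1 + ln (real n))) \<le> ?prob n"
    using small eventually_ge_at_top[of 3]
  proof eventually_elim
    case (elim n)
    have ln0: "0 \<le> ln (real n)" using elim by simp
    have "720 * ln n / n \<le> K * (ln n / n)"
      using K ln0 mult_right_mono[of 720 K "ln n / n"] by simp
    then have "720 * ln n / n \<le> 1" using elim by linarith
    then obtain q where q: "0 \<le> q" "q \<le> 720 * ln n / n" "q \<le> 1"
      and miss: "miss (positions n) {1..n} (transversals n) q \<le> 1 / sqrt (1 + ln n)"
      using miss_transversals_le[OF elim(2)] by blast
    have "K * real n * ln n \<le> (real n)\<^sup>2"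
      using elim by (simp add: field_simps power2_eq_square)
    then have m_le: "m n \<le> n\<^sup>2"
      by (simp add: m_def nat_le_iff ceiling_le_iff)
    have "2 * (real n)\<^sup>2 * q \<le> 2 * (real n)\<^sup>2 * (720 * ln n / n)"
      using q by (intro mult_left_mono) auto
    also have "\<dots> = 1440 * (real n * ln n)"
      using elim by (simp add: power2_eq_square)
    also have "\<dots> \<le> K * (real n * ln n)"
      using K ln0 by (intro mult_right_mono) auto
    also have "\<dots> \<le> m n" unfolding m_def by (simp add: mult.assoc) linarith
    finally have "2 * n\<^sup>2 * q \<le> m n" by simp
    then have "1 - 2 * miss (positions n) {1..n} (transversals n) q \<le> ?prob n"
      using elim q m_le by (intro prob_latin_transversal_ge) auto
    then show ?case using miss by linarith
  qed
  have "filterlim (\<lambda>n. sqrt (1 + ln (real n))) at_top sequentially"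
    by (intro filterlim_compose[OF sqrt_at_top] filterlim_tendsto_add_at_top[OF tendsto_const]
              filterlim_compose[OF ln_at_top] filterlim_real_sequentially)
  then have "(\<lambda>n. 1 - 2 * (1 / sqrt (1 + ln (real n)))) \<longlonglongrightarrow> 1 - 2 * 0"
    by (intro tendsto_intros real_tendsto_divide_at_top[OF tendsto_const])
  then have "?prob \<longlonglongrightarrow> 1"
    by (intro tendsto_sandwich[OF lower _ _ tendsto_const]) auto
  then show "(\<lambda>n. measure_pmf.prob (random_matrix n (nat \<lceil>K * real n * ln (real n)\<rceil>))
      {A. contains_latin_transversal n A}) \<longlonglongrightarrow> 1"
    by (simp only: m_def)
qed

end
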